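(* Let $X=(X_1,\ldots,X_n)^\top$ with independently distributed components $X_i\sim N_d(\mu,\sigma^2I_d)$, $\theta=(\mu,\sigma^2)$ with $\mu\in\mathbb{R}^d$ and $\sigma^2>0$ both unknown, and let $\bar X=\frac1n\sum_{i=1}^nX_i$. Let $\beta:[0,\infty)\to[0,\infty)$ be absolutely continuous and strictly increasing with $\mathbb{E}\{\beta(Z)\}<\infty$, where $Z\sim\chi^2_d$. Consider estimating the loss $L=\beta\big(\frac{\|\bar X-\mu\|^2}{\sigma^2/n}\big)$ incurred by $\hat\gamma(X)=\bar X$ for estimating $\gamma(\theta)=\mu$. (1) Let $m\ne0$ and suppose that $\mathbb{E}(\log\beta(Z))$ and $\mathbb{E}((\beta(Z))^{-m})$ exist (are finite). Under second-stage loss $W(L,\hat L)=\rho_m\big(\frac{\hat L}{L}\big)$ with $\rho_m(t)=t^m-m\log t-1$, the (constant) estimator $\hat L_{\pi_0}=\big\{\mathbb{E}\big((\beta(Z))^{-m}\big)\big\}^{-1/m}$ is minimax for estimating $L$. (2) For $j\in\{A,B,C\}$, under second-stage loss $\rho_j\big(\frac{\hat L}{L}\big)$, where $\rho_A(t)=(t^m-1)^2$ ($m\ne0$), $\rho_B(t)=\frac12(t+\frac1t-2)$, $\rho_C(t)=(\log t)^2$, the generalized Bayes estimator $\hat L_{\pi_0,j}$, assuming that it exists and has finite risk, is minimax for estimating $L$.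
   Context: An estimator of $L$ is a function $\hat L(X)$ of $X$ with values in $(0,\infty)$. Its frequentist risk under second-stage loss $W$ is $R(\theta,\hat L)=\mathbb{E}_\theta\big(W(L,\hat L(X))\big)$, where $L$ also depends on $X$ and $\theta$. An estimator $\hat L_0(X)$ is minimax if $\sup_\theta R(\theta,\hat L_0)=\inf_{\hat L}\sup_\theta R(\theta,\hat L)$, the supremum being over all $\theta=(\mu,\sigma^2)\in\mathbb{R}^d\times(0,\infty)$. $\chi^2_d$ is the central chi-square distribution with $d$ degrees of freedom. $\hat L_{\pi_0,j}$ is the generalized Bayes estimator of $L$ for known $\sigma^2$ and the uniform prior density $\pi_0(\mu)=1$ on $\mathbb{R}^d$, i.e. the minimizer over $\hat L>0$ of the posterior expectation $\mathbb{E}\big(\rho_j(\hat L/L)\,|\,x\big)$; since under $\pi_0$ the posterior distribution of $\frac{\|\bar x-\mu\|^2}{\sigma^2/n}$ is $\chi^2_d$, this is the constant minimizing $\mathbb{E}\big(\rho_j(\hat L/\beta(Z))\big)$, which does not depend on $x$ or $\sigma^2$. *)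

theory Defs
  imports "HOL-Probability.Probability"
begin

text \<open>A parameter \<open>(\<mu>, \<sigma>\<^sup>2)\<close> is represented by \<open>\<mu> :: real ^ 'd\<close> and the variance \<open>v = \<sigma>\<^sup>2 > 0\<close>;
  thus \<open>v\<close> is never a standard deviation.\<close>

definition iso_normal_density :: "real ^ 'd \<Rightarrow> real \<Rightarrow> real ^ 'd \<Rightarrow> real" where
  "iso_normal_density \<mu> v x =
     exp (- (norm (x - \<mu>))\<^sup>2 / (2 * v)) / sqrt (2 * pi * v) ^ CARD('d)"

definition iso_normal :: "real ^ 'd \<Rightarrow> real \<Rightarrow> (real ^ 'd) measure" where
  "iso_normal \<mu> v = density lborel (\<lambda>x. ennreal (iso_normal_density \<mu> v x))"

text \<open>The law of the sum of the squares of \<open>d\<close> independent standard normal variables.\<close>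

definition chi_square :: "nat \<Rightarrow> real measure" where
  "chi_square d =
     distr (\<Pi>\<^sub>M i\<in>{..<d}. density lborel std_normal_density) borel (\<lambda>z. \<Sum>i<d. (z i)\<^sup>2)"

text \<open>Absolute continuity on \<open>[0,\<infinity>)\<close> is meant locally, that is, on each compact interval
  \<open>[0,b]\<close>; the families of intervals below are finite with pairwise disjoint interiors.\<close>

definition abs_continuous_on_interval :: "real \<Rightarrow> real \<Rightarrow> (real \<Rightarrow> real) \<Rightarrow> bool" where
  "abs_continuous_on_interval a b f \<longleftrightarrow>
     (\<forall>\<epsilon>>0. \<exists>\<delta>>0. \<forall>(N::nat) s t.
        (\<forall>i<N. a \<le> s i \<and> s i \<le> t i \<and> t i \<le> b) \<longrightarrow>
        disjoint_family_on (\<lambda>i. {s i<..<t i}) {..<N} \<longrightarrow>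
        (\<Sum>i<N. t i - s i) < \<delta> \<longrightarrow>
        (\<Sum>i<N. \<bar>f (t i) - f (s i)\<bar>) < \<epsilon>)"

definition abs_continuous_halfline :: "(real \<Rightarrow> real) \<Rightarrow> bool" where
  "abs_continuous_halfline f \<longleftrightarrow> (\<forall>b\<ge>0. abs_continuous_on_interval 0 b f)"

definition sample_space :: "nat \<Rightarrow> (nat \<Rightarrow> real ^ 'd) measure" where
  "sample_space n = (\<Pi>\<^sub>M i\<in>{..<n}. borel)"

definition sample_law :: "nat \<Rightarrow> real ^ 'd \<Rightarrow> real \<Rightarrow> (nat \<Rightarrow> real ^ 'd) measure" where
  "sample_law n \<mu> v = (\<Pi>\<^sub>M i\<in>{..<n}. iso_normal \<mu> v)"

definition sample_mean :: "nat \<Rightarrow> (nat \<Rightarrow> real ^ 'd) \<Rightarrow> real ^ 'd" where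
  "sample_mean n x = (1 / real n) *\<^sub>R (\<Sum>i<n. x i)"

definition first_loss ::
    "(real \<Rightarrow> real) \<Rightarrow> nat \<Rightarrow> real ^ 'd \<Rightarrow> real \<Rightarrow> (nat \<Rightarrow> real ^ 'd) \<Rightarrow> real" where
  "first_loss \<beta> n \<mu> v x = \<beta> ((norm (sample_mean n x - \<mu>))\<^sup>2 / (v / real n))"

definition estimators :: "nat \<Rightarrow> ((nat \<Rightarrow> real ^ 'd) \<Rightarrow> real) set" where
  "estimators n =
     {\<delta> \<in> borel_measurable (sample_space n). \<forall>x\<in>space (sample_space n). 0 < \<delta> x}"

text \<open>A second-stage loss \<open>W L l\<close> takes the true loss \<open>L\<close> and its estimate \<open>l\<close>.  All losses of
  interest are nonnegative for \<open>L > 0\<close>, so risks are extended nonnegative integrals.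
  (For strictly increasing \<open>\<beta> \<ge> 0\<close>, the event \<open>L = 0\<close>, where \<open>l / L\<close> is a junk value,
  is a null set.)\<close>

definition risk ::
    "(real \<Rightarrow> real \<Rightarrow> real) \<Rightarrow> (real \<Rightarrow> real) \<Rightarrow> nat \<Rightarrow>
     real ^ 'd \<Rightarrow> real \<Rightarrow> ((nat \<Rightarrow> real ^ 'd) \<Rightarrow> real) \<Rightarrow> ennreal" where
  "risk W \<beta> n \<mu> v \<delta> =
     (\<integral>\<^sup>+ x. ennreal (W (first_loss \<beta> n \<mu> v x) (\<delta> x)) \<partial>sample_law n \<mu> v)"

definition sup_risk ::
    "(real \<Rightarrow> real \<Rightarrow> real) \<Rightarrow> (real \<Rightarrow> real) \<Rightarrow> nat \<Rightarrow>
     ((nat \<Rightarrow> real ^ 'd) \<Rightarrow> real) \<Rightarrow> ennreal" where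
  "sup_risk W \<beta> n \<delta> = (SUP (\<mu>, v) \<in> UNIV \<times> {0<..}. risk W \<beta> n \<mu> v \<delta>)"

definition minimax ::
    "(real \<Rightarrow> real \<Rightarrow> real) \<Rightarrow> (real \<Rightarrow> real) \<Rightarrow> nat \<Rightarrow>
     ((nat \<Rightarrow> real ^ 'd) \<Rightarrow> real) \<Rightarrow> bool" where
  "minimax W \<beta> n \<delta> \<longleftrightarrow>
     \<delta> \<in> estimators n \<and>
     sup_risk W \<beta> n \<delta> = (INF \<delta>' \<in> (estimators n :: ((nat \<Rightarrow> real ^ 'd) \<Rightarrow> real) set). sup_risk W \<beta> n \<delta>')"

definition likelihood :: "nat \<Rightarrow> real \<Rightarrow> (nat \<Rightarrow> real ^ 'd) \<Rightarrow> real ^ 'd \<Rightarrow> real" where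
  "likelihood n v x \<mu> = (\<Prod>i<n. iso_normal_density \<mu> v (x i))"

text \<open>Posterior of \<open>\<mu>\<close>, for known variance \<open>v\<close>, under a possibly improper prior density.\<close>

definition posterior ::
    "(real ^ 'd \<Rightarrow> real) \<Rightarrow> nat \<Rightarrow> real \<Rightarrow> (nat \<Rightarrow> real ^ 'd) \<Rightarrow> (real ^ 'd) measure" where
  "posterior prior n v x =
     density lborel (\<lambda>\<mu>. ennreal (likelihood n v x \<mu> * prior \<mu>) /
       (\<integral>\<^sup>+ \<mu>'. ennreal (likelihood n v x \<mu>' * prior \<mu>') \<partial>lborel))"

definition posterior_risk ::
    "(real \<Rightarrow> real \<Rightarrow> real) \<Rightarrow> (real \<Rightarrow> real) \<Rightarrow> (real ^ 'd \<Rightarrow> real) \<Rightarrow> nat \<Rightarrow> real \<Rightarrow>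
     (nat \<Rightarrow> real ^ 'd) \<Rightarrow> real \<Rightarrow> ennreal" where
  "posterior_risk W \<beta> prior n v x l =
     (\<integral>\<^sup>+ \<mu>. ennreal (W (first_loss \<beta> n \<mu> v x) l) \<partial>posterior prior n v x)"

text \<open>At every sample point a (generalized) Bayes estimator minimizes the posterior expected loss,
  whose minimum is required to be finite (otherwise every positive value would be a minimizer).\<close>

definition generalized_bayes ::
    "(real \<Rightarrow> real \<Rightarrow> real) \<Rightarrow> (real \<Rightarrow> real) \<Rightarrow> (real ^ 'd \<Rightarrow> real) \<Rightarrow> nat \<Rightarrow> real \<Rightarrow>
     ((nat \<Rightarrow> real ^ 'd) \<Rightarrow> real) \<Rightarrow> bool" where
  "generalized_bayes W \<beta> prior n v \<delta> \<longleftrightarrow>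
     \<delta> \<in> estimators n \<and>
     (\<forall>x\<in>space (sample_space n).
        posterior_risk W \<beta> prior n v x (\<delta> x) < \<infinity> \<and>
        (\<forall>l>0. posterior_risk W \<beta> prior n v x (\<delta> x) \<le> posterior_risk W \<beta> prior n v x l))"

definition uniform_prior :: "real ^ 'd \<Rightarrow> real" where
  "uniform_prior \<mu> = 1"

definition ratio_loss :: "(real \<Rightarrow> real) \<Rightarrow> real \<Rightarrow> real \<Rightarrow> real" where
  "ratio_loss \<rho> L l = \<rho> (l / L)"

definition rho :: "real \<Rightarrow> real \<Rightarrow> real" where
  "rho m t = t powr m - m * ln t - 1"

definition rho_A :: "real \<Rightarrow> real \<Rightarrow> real" where
  "rho_A m t = (t powr m - 1)\<^sup>2"

definition rho_B :: "real \<Rightarrow> real" where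
  "rho_B t = (t + 1 / t - 2) / 2"

definition rho_C :: "real \<Rightarrow> real" where
  "rho_C t = (ln t)\<^sup>2"

end

theory Submission
  imports Defs
begin

text \<open>
  Write \<open>Z\<close> for the scaled squared error \<open>\<parallel>sample_mean n x - \<mu>\<parallel>\<^sup>2 / (v / n)\<close> of the sample mean and
  \<open>F l = E (\<rho> (l / \<beta> Z))\<close> (\<open>constant_risk\<close>).  Under every parameter \<open>Z\<close> has the chi-square law with \<open>d\<close>
  degrees of freedom, so the constant estimator \<open>l\<close> has risk \<open>F l\<close> throughout
  (\<open>risk_of_constant\<close>).  Under the flat prior on \<open>\<mu>\<close> the posterior law of \<open>\<mu>\<close> is normal around the
  sample mean, so \<open>F l\<close> is also the posterior expected loss of the value \<open>l\<close>, whatever the sample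
  (\<open>posterior_risk_uniform\<close>).  The estimators in question are constants minimizing \<open>F\<close>:
  for \<open>rho m\<close> by a direct computation (\<open>rho_minimizer\<close>), and for the other losses because a
  generalized Bayes estimator minimizes \<open>F\<close> at every sample and \<open>F\<close> has only one minimizer
  (\<open>constant_risk_minimizer_unique\<close>).

  What remains is that no estimator has maximal risk below \<open>min F\<close> (\<open>minimax_constant\<close>).  This
  is already true for a known variance.  Under the uniform prior on a ball of radius \<open>k\<close>, the
  posterior of \<open>\<mu>\<close> coincides up to a factor with the one for the flat prior, within distance \<open>M\<close> of
  the sample mean, for all samples with mean in the ball of radius \<open>k - M\<close>.  As \<open>k\<close> tends
  to infinity the other samples become negligible, and the maximal risk is at least the infimum
  over \<open>l\<close> of the risk \<open>F\<close> truncated to errors of size at most \<open>M\<close>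
  (\<open>location_risk_lower_bound\<close>).  As \<open>M\<close> tends to infinity these infima tend to \<open>min F\<close>, by
  compactness of \<open>[0,\<infinity>]\<close> and Fatou's lemma (\<open>truncated_risk_recovers_infimum\<close>), provided that \<open>min F\<close>
  does not exceed the limits of \<open>\<rho>\<close> at \<open>0\<close> and at infinity.  These limits are infinite, except
  that \<open>rho_A m\<close> tends to \<open>1\<close> at one end, and there \<open>min F \<le> 1\<close>
  (\<open>constant_risk_rho_A_le_1\<close>).

  Both the posterior and the law of the sample mean come from one identity: the likelihood is a
  function of the sample alone times a normal density in \<open>\<mu>\<close> centred at the sample mean
  (\<open>likelihood_eq_marginal_times_normal\<close>).  Integrated over \<open>\<mu>\<close> and combined with the translation
  invariance of Lebesgue measure, it replaces the usual convolution of normal laws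
  (\<open>nn_integral_sample_mean\<close>).
\<close>

section \<open>Euclidean normal laws and the chi-square law\<close>

lemma PiM_density:
  fixes f :: "'i \<Rightarrow> 'a \<Rightarrow> ennreal"
  assumes "finite I" and M: "\<And>i. sigma_finite_measure (M i)"
    and f [measurable]: "\<And>i. f i \<in> borel_measurable (M i)"
    and D: "\<And>i. sigma_finite_measure (density (M i) (f i))"
  shows "PiM I (\<lambda>i. density (M i) (f i)) = density (PiM I M) (\<lambda>x. \<Prod>i\<in>I. f i (x i))"
proof -
  interpret M: product_sigma_finite M by (simp add: product_sigma_finite_def M)
  interpret D: product_sigma_finite "\<lambda>i. density (M i) (f i)"
    by (simp add: product_sigma_finite_def D)
  have "density (PiM I M) (\<lambda>x. \<Prod>i\<in>I. f i (x i)) = PiM I (\<lambda>i. density (M i) (f i))"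
  proof (rule D.PiM_eqI)
    show "sets (density (PiM I M) (\<lambda>x. \<Prod>i\<in>I. f i (x i))) = sets (PiM I (\<lambda>i. density (M i) (f i)))"
      by (simp cong: sets_PiM_cong)
  next
    fix A assume A: "\<And>i. i \<in> I \<Longrightarrow> A i \<in> sets (density (M i) (f i))"
    then have A' [measurable]: "\<And>i. i \<in> I \<Longrightarrow> A i \<in> sets (M i)" by simp
    have P [measurable]: "Pi\<^sub>E I A \<in> sets (PiM I M)"
      using \<open>finite I\<close> A' by (rule sets_PiM_I_finite)
    have ind: "indicator (Pi\<^sub>E I A) x = (\<Prod>i\<in>I. indicator (A i) (x i) :: ennreal)"
      if "x \<in> space (PiM I M)" for x
      using that \<open>finite I\<close> by (auto simp: space_PiM PiE_iff indicator_def extensional_def prod_zero_iff)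
    have "emeasure (density (PiM I M) (\<lambda>x. \<Prod>i\<in>I. f i (x i))) (Pi\<^sub>E I A)
        = (\<integral>\<^sup>+x. (\<Prod>i\<in>I. f i (x i)) * indicator (Pi\<^sub>E I A) x \<partial>PiM I M)"
      by (rule emeasure_density) measurable
    also have "\<dots> = (\<integral>\<^sup>+x. (\<Prod>i\<in>I. f i (x i) * indicator (A i) (x i)) \<partial>PiM I M)"
      by (intro nn_integral_cong) (simp add: ind prod.distrib)
    also have "\<dots> = (\<Prod>i\<in>I. \<integral>\<^sup>+x. f i x * indicator (A i) x \<partial>M i)"
      using \<open>finite I\<close> by (intro M.product_nn_integral_prod) measurable
    also have "\<dots> = (\<Prod>i\<in>I. emeasure (density (M i) (f i)) (A i))"
      by (intro prod.cong refl) (simp add: emeasure_density)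
    finally show "emeasure (density (PiM I M) (\<lambda>x. \<Prod>i\<in>I. f i (x i))) (Pi\<^sub>E I A)
        = (\<Prod>i\<in>I. emeasure (density (M i) (f i)) (A i))" .
  qed fact
  then show ?thesis by simp
qed

lemma nn_integral_lborel_affine:
  fixes f :: "'a::euclidean_space \<Rightarrow> ennreal"
  assumes [measurable]: "f \<in> borel_measurable borel" and c: "c \<noteq> 0"
  shows "(\<integral>\<^sup>+x. f x \<partial>lborel) = ennreal (\<bar>c\<bar> ^ DIM('a)) * (\<integral>\<^sup>+x. f (t + c *\<^sub>R x) \<partial>lborel)"
  by (subst lborel_affine[OF c, of t])
     (simp add: nn_integral_density nn_integral_distr nn_integral_cmult)

lemma iso_normal_density_nonneg [simp]: "v > 0 \<Longrightarrow> 0 \<le> iso_normal_density \<mu> v x"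
  by (simp add: iso_normal_density_def)

lemma iso_normal_density_pos: "v > 0 \<Longrightarrow> 0 < iso_normal_density \<mu> v x"
  by (simp add: iso_normal_density_def)

lemma borel_measurable_iso_normal_density [measurable]:
  "(\<lambda>(\<mu>, x). iso_normal_density \<mu> v x) \<in> borel_measurable (borel \<Otimes>\<^sub>M borel)"
  unfolding iso_normal_density_def by measurable

lemma borel_measurable_iso_normal_density1 [measurable]:
  "iso_normal_density \<mu> v \<in> borel_measurable borel"
  using measurable_Pair2[OF borel_measurable_iso_normal_density, of \<mu>] by simp

lemma sets_iso_normal [simp, measurable_cong]: "sets (iso_normal \<mu> v) = sets borel"
  by (simp add: iso_normal_def)

lemma space_iso_normal [simp]: "space (iso_normal \<mu> v) = UNIV"
  by (simp add: iso_normal_def)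

lemma nn_integral_iso_normal:
  assumes [measurable]: "f \<in> borel_measurable borel"
  shows "(\<integral>\<^sup>+x. f x \<partial>iso_normal \<mu> v) = (\<integral>\<^sup>+x. ennreal (iso_normal_density \<mu> v x) * f x \<partial>lborel)"
  by (simp add: iso_normal_def nn_integral_density)

text \<open>Scaling by \<open>sqrt v\<close> has Jacobian \<open>sqrt v ^ d\<close>, which is what separates the two
  normalizing constants.\<close>

lemma nn_integral_iso_normal_standardize:
  fixes \<mu> :: "real ^ 'd"
  assumes [measurable]: "f \<in> borel_measurable borel" and v: "v > 0"
  shows "(\<integral>\<^sup>+x. f x \<partial>iso_normal \<mu> v) = (\<integral>\<^sup>+x. f (\<mu> + sqrt v *\<^sub>R x) \<partial>iso_normal 0 1)"
proof -
  have dens: "ennreal (sqrt v ^ CARD('d)) * ennreal (iso_normal_density \<mu> v (\<mu> + sqrt v *\<^sub>R x))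
      = ennreal (iso_normal_density 0 1 x)" for x :: "real ^ 'd"
  proof -
    have "(norm (sqrt v *\<^sub>R x))\<^sup>2 / (2 * v) = (norm x)\<^sup>2 / 2"
      using v by (simp add: power_mult_distrib)
    moreover have "sqrt (2 * pi * v) ^ CARD('d) = sqrt v ^ CARD('d) * sqrt (2 * pi) ^ CARD('d)"
      by (simp add: real_sqrt_mult power_mult_distrib)
    ultimately have "sqrt v ^ CARD('d) * iso_normal_density \<mu> v (\<mu> + sqrt v *\<^sub>R x)
        = iso_normal_density 0 1 x"
      using v by (simp add: iso_normal_density_def)
    then show ?thesis using v by (simp flip: ennreal_mult)
  qed
  have "(\<integral>\<^sup>+x. f x \<partial>iso_normal \<mu> v)
      = ennreal (\<bar>sqrt v\<bar> ^ DIM(real ^ 'd)) *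
        (\<integral>\<^sup>+x. ennreal (iso_normal_density \<mu> v (\<mu> + sqrt v *\<^sub>R x)) * f (\<mu> + sqrt v *\<^sub>R x) \<partial>lborel)"
    unfolding nn_integral_iso_normal[OF assms(1)]
    by (rule nn_integral_lborel_affine) (use v in simp_all)
  also have "\<dots> = (\<integral>\<^sup>+x. ennreal (iso_normal_density 0 1 x) * f (\<mu> + sqrt v *\<^sub>R x) \<partial>lborel)"
    using v by (simp add: nn_integral_cmult[symmetric] mult.assoc[symmetric] dens)
  also have "\<dots> = (\<integral>\<^sup>+x. f (\<mu> + sqrt v *\<^sub>R x) \<partial>iso_normal 0 1)"
    by (simp add: nn_integral_iso_normal)
  finally show ?thesis .
qed

lemma prob_space_std_normal: "prob_space (density lborel std_normal_density)"
  by (simp add: prob_space_normal_density)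

lemma sets_chi_square [simp, measurable_cong]: "sets (chi_square d) = sets borel"
  by (simp add: chi_square_def)

lemma space_chi_square [simp]: "space (chi_square d) = UNIV"
  by (simp add: chi_square_def)

text \<open>Lebesgue measure on a Euclidean space is the product of one copy of the real one for every basis
  vector, and the standard normal density factorizes along it.  Any enumeration of the basis then
  carries the product over basis vectors to the product over \<open>{..<d}\<close> in the chi-square law.\<close>

lemma nn_integral_std_iso_normal:
  assumes f [measurable]: "f \<in> borel_measurable borel"
  shows "(\<integral>\<^sup>+x. f ((norm (x :: real ^ 'd))\<^sup>2) \<partial>iso_normal 0 1) = (\<integral>\<^sup>+z. f z \<partial>chi_square CARD('d))"
proof -
  let ?B = "Basis :: (real ^ 'd) set"
  let ?N = "density lborel std_normal_density"
  let ?s = "\<lambda>g. \<Sum>b\<in>?B. g b *\<^sub>R b :: real ^ 'd"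
  interpret N: prob_space ?N by (rule prob_space_std_normal)
  have fin: "finite ?B" by simp
  have nrm: "(norm (?s g))\<^sup>2 = (\<Sum>b\<in>?B. (g b)\<^sup>2)" for g
    unfolding power2_norm_eq_inner by (subst euclidean_inner) (simp add: power2_eq_square)
  have dens: "ennreal (iso_normal_density 0 1 (?s g)) = (\<Prod>b\<in>?B. ennreal (std_normal_density (g b)))" for g
  proof -
    have "(\<Prod>b\<in>?B. std_normal_density (g b))
        = (1 / sqrt (2 * pi)) ^ CARD('d) * exp (\<Sum>b\<in>?B. - (g b)\<^sup>2 / 2)"
      unfolding std_normal_density_def by (simp only: prod.distrib exp_sum[OF fin]) simp
    also have "\<dots> = iso_normal_density 0 1 (?s g)"
      by (simp add: iso_normal_density_def nrm sum_negf sum_divide_distrib power_one_over)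
    finally have "iso_normal_density 0 1 (?s g) = (\<Prod>b\<in>?B. std_normal_density (g b))" ..
    then show ?thesis by (simp add: prod_ennreal)
  qed
  obtain e where e: "bij_betw e {..<CARD('d)} ?B"
    using finite_same_card_bij[of "{..<CARD('d)}" ?B] by auto
  have emeas [measurable]: "(\<lambda>g. \<lambda>i\<in>{..<CARD('d)}. g (e i)) \<in> PiM ?B (\<lambda>_. ?N) \<rightarrow>\<^sub>M (\<Pi>\<^sub>M i\<in>{..<CARD('d)}. ?N)"
    using e by (intro measurable_restrict measurable_component_singleton) (auto simp: bij_betw_def)
  have "(\<integral>\<^sup>+x. f ((norm (x :: real ^ 'd))\<^sup>2) \<partial>iso_normal 0 1)
      = (\<integral>\<^sup>+g. (\<Prod>b\<in>?B. ennreal (std_normal_density (g b))) * f (\<Sum>b\<in>?B. (g b)\<^sup>2) \<partial>PiM ?B (\<lambda>_. lborel))"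
    by (subst nn_integral_iso_normal, measurable, subst lborel_eq)
       (simp add: nn_integral_distr dens nrm)
  also have "\<dots> = (\<integral>\<^sup>+g. f (\<Sum>b\<in>?B. (g b)\<^sup>2) \<partial>density (PiM ?B (\<lambda>_. lborel)) (\<lambda>g. \<Prod>b\<in>?B. ennreal (std_normal_density (g b))))"
    by (rule nn_integral_density[symmetric]) measurable
  also have "density (PiM ?B (\<lambda>_. lborel)) (\<lambda>g. \<Prod>b\<in>?B. ennreal (std_normal_density (g b))) = PiM ?B (\<lambda>_. ?N)"
    by (rule PiM_density[symmetric]) (auto intro: lborel.sigma_finite_measure_axioms N.sigma_finite_measure_axioms)
  also have "(\<integral>\<^sup>+g. f (\<Sum>b\<in>?B. (g b)\<^sup>2) \<partial>PiM ?B (\<lambda>_. ?N))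
      = (\<integral>\<^sup>+g. f (\<Sum>i<CARD('d). (g (e i))\<^sup>2) \<partial>PiM ?B (\<lambda>_. ?N))"
    by (simp add: sum.reindex_bij_betw[OF e, of "\<lambda>b. (g b)\<^sup>2" for g])
  also have "\<dots> = (\<integral>\<^sup>+g. f (\<Sum>i<CARD('d). (g i)\<^sup>2)
      \<partial>distr (PiM ?B (\<lambda>_. ?N)) (\<Pi>\<^sub>M i\<in>{..<CARD('d)}. ?N) (\<lambda>g. \<lambda>i\<in>{..<CARD('d)}. g (e i)))"
    by (subst nn_integral_distr) auto
  also have "distr (PiM ?B (\<lambda>_. ?N)) (\<Pi>\<^sub>M i\<in>{..<CARD('d)}. ?N) (\<lambda>g. \<lambda>i\<in>{..<CARD('d)}. g (e i))
      = (\<Pi>\<^sub>M i\<in>{..<CARD('d)}. ?N)"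
    using e by (intro distr_PiM_reindex prob_space_std_normal) (auto simp: bij_betw_def)
  also have "(\<integral>\<^sup>+g. f (\<Sum>i<CARD('d). (g i)\<^sup>2) \<partial>(\<Pi>\<^sub>M i\<in>{..<CARD('d)}. ?N)) = (\<integral>\<^sup>+z. f z \<partial>chi_square CARD('d))"
    unfolding chi_square_def by (subst nn_integral_distr) auto
  finally show ?thesis .
qed

lemma prob_space_chi_square: "prob_space (chi_square d)"
proof -
  interpret prob_space "\<Pi>\<^sub>M i\<in>{..<d}. density lborel std_normal_density"
    by (intro prob_space_PiM prob_space_std_normal)
  show ?thesis unfolding chi_square_def by (rule prob_space_distr) measurable
qed

lemma nn_integral_chi_square:
  fixes \<mu> :: "real ^ 'd"
  assumes [measurable]: "f \<in> borel_measurable borel" and v: "v > 0"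
  shows "(\<integral>\<^sup>+x. f ((norm (x - \<mu>))\<^sup>2 / v) \<partial>iso_normal \<mu> v) = (\<integral>\<^sup>+z. f z \<partial>chi_square CARD('d))"
  using v by (subst nn_integral_iso_normal_standardize)
    (simp_all add: power_mult_distrib nn_integral_std_iso_normal)

lemma prob_space_iso_normal:
  assumes "v > 0" shows "prob_space (iso_normal \<mu> v)"
proof (rule prob_spaceI)
  show "emeasure (iso_normal \<mu> v) (space (iso_normal \<mu> v)) = 1"
    using nn_integral_chi_square[of "\<lambda>_. 1" v \<mu>, OF borel_measurable_const assms]
      prob_space.emeasure_space_1[OF prob_space_chi_square, of "CARD('a)"]
    by (simp only: nn_integral_const mult_1 space_iso_normal space_chi_square)
qed

text \<open>The value \<open>0\<close> is taken only at the origin, a Lebesgue null set.  Hence the event \<open>L = 0\<close>, in which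
  the ratio \<open>l / L\<close> is a default value, never contributes to a risk.\<close>

lemma AE_chi_square_pos: "AE z in chi_square CARD('d::finite). 0 < z"
proof -
  have [measurable]: "{..0::real} \<in> sets borel" by simp
  have "emeasure (chi_square CARD('d)) {..0} = (\<integral>\<^sup>+x. indicator {..0} ((norm (x :: real ^ 'd))\<^sup>2) \<partial>iso_normal 0 1)"
    by (simp add: nn_integral_std_iso_normal)
  also have "\<dots> = (\<integral>\<^sup>+x. 0 \<partial>iso_normal (0 :: real ^ 'd) 1)"
  proof (rule nn_integral_cong_AE)
    have "AE x :: real ^ 'd in lborel. x \<noteq> 0" by (rule AE_lborel_singleton)
    then show "AE x :: real ^ 'd in iso_normal 0 1. indicator {..0} ((norm x)\<^sup>2) = (0 :: ennreal)"
      unfolding iso_normal_def by (subst AE_density) (auto elim!: eventually_mono)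
  qed
  finally have "{..0} \<in> null_sets (chi_square CARD('d))" by (simp add: null_sets_def)
  then show ?thesis by (rule AE_I') (auto simp: not_less)
qed

section \<open>The normal sample under the flat prior\<close>

lemma sets_sample_law [simp, measurable_cong]: "sets (sample_law n \<mu> v) = sets (sample_space n)"
  unfolding sample_law_def sample_space_def by (intro sets_PiM_cong) simp_all

lemma space_sample_law [simp]: "space (sample_law n \<mu> v) = space (sample_space n)"
  by (rule sets_eq_imp_space_eq) simp

lemma prob_space_sample_law: "v > 0 \<Longrightarrow> prob_space (sample_law n \<mu> v)"
  unfolding sample_law_def by (intro prob_space_PiM prob_space_iso_normal)

abbreviation sample_lborel :: "nat \<Rightarrow> (nat \<Rightarrow> real ^ 'd) measure" where
  "sample_lborel n \<equiv> \<Pi>\<^sub>M i\<in>{..<n}. lborel"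

lemma sets_sample_lborel: "sets (sample_lborel n) = sets (sample_space n)"
  unfolding sample_space_def by (intro sets_PiM_cong) simp_all

lemma sigma_finite_sample_lborel: "sigma_finite_measure (sample_lborel n)"
proof -
  interpret product_sigma_finite "\<lambda>_. lborel :: (real ^ 'd) measure"
    by (simp add: product_sigma_finite_def lborel.sigma_finite_measure_axioms)
  show ?thesis by (rule sigma_finite) simp
qed

lemma measurable_sample_component:
  "i < n \<Longrightarrow> (\<lambda>x. x i) \<in> sample_space n \<rightarrow>\<^sub>M borel"
  unfolding sample_space_def by simp

lemma measurable_sample_mean [measurable]: "sample_mean n \<in> sample_space n \<rightarrow>\<^sub>M borel"
proof -
  have "(\<lambda>x. \<Sum>i<n. x i) \<in> sample_space n \<rightarrow>\<^sub>M borel"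
    by (intro borel_measurable_sum measurable_sample_component) simp
  then show ?thesis unfolding sample_mean_def[abs_def] by measurable
qed

lemma measurable_likelihood [measurable]:
  assumes [measurable]: "f \<in> M \<rightarrow>\<^sub>M sample_space n" "g \<in> M \<rightarrow>\<^sub>M borel"
  shows "(\<lambda>w. likelihood n v (f w) (g w)) \<in> borel_measurable M"
  unfolding likelihood_def
proof (intro borel_measurable_prod)
  fix i assume "i \<in> {..<n}"
  then have [measurable]: "(\<lambda>w. f w i) \<in> M \<rightarrow>\<^sub>M borel"
    using measurable_compose[OF assms(1) measurable_sample_component] by simp
  show "(\<lambda>w. iso_normal_density (g w) v (f w i)) \<in> borel_measurable M"
    unfolding iso_normal_density_def by measurable
qed

lemma sample_law_eq_density:
  assumes "v > 0"
  shows "sample_law n \<mu> v = density (sample_lborel n) (\<lambda>x. ennreal (likelihood n v x \<mu>))"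
proof -
  have "sigma_finite_measure (density lborel (\<lambda>x. ennreal (iso_normal_density \<mu> v x)))"
    by (simp add: prob_space_imp_sigma_finite prob_space_iso_normal[OF assms] flip: iso_normal_def)
  then show ?thesis
    unfolding sample_law_def iso_normal_def likelihood_def
    by (subst PiM_density) (auto intro!: lborel.sigma_finite_measure_axioms simp: prod_ennreal assms)
qed

text \<open>The cross terms sum to the inner product of \<open>\<Sum>i<n. x i - sample_mean n x = 0\<close> with
  \<open>sample_mean n x - \<mu>\<close>.\<close>

lemma sum_norm_sq_about_mean:
  fixes x :: "nat \<Rightarrow> real ^ 'd"
  assumes "n \<ge> 1"
  shows "(\<Sum>i<n. (norm (x i - \<mu>))\<^sup>2)
    = (\<Sum>i<n. (norm (x i - sample_mean n x))\<^sup>2) + real n * (norm (sample_mean n x - \<mu>))\<^sup>2"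
proof -
  let ?m = "sample_mean n x"
  have "(norm (x i - \<mu>))\<^sup>2 = (norm (x i - ?m))\<^sup>2 + 2 * ((x i - ?m) \<bullet> (?m - \<mu>)) + (norm (?m - \<mu>))\<^sup>2" for i
    by (simp add: power2_norm_eq_inner algebra_simps inner_commute)
  moreover have "(\<Sum>i<n. (x i - ?m) \<bullet> (?m - \<mu>)) = 0"
    using assms by (simp add: inner_sum_left[symmetric] sum_subtractf sample_mean_def sum_constant_scaleR del: sum_constant)
  ultimately show ?thesis
    by (simp add: sum.distrib sum_distrib_left[symmetric])
qed

text \<open>The marginal density of the sample under the improper prior \<open>d\<mu>\<close>: the likelihood, as a function
  of \<open>\<mu>\<close>, is proportional to a normal density around the sample mean, and this is the factor of
  proportionality, read off at \<open>\<mu> = sample_mean n x\<close>.\<close>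

definition flat_marginal :: "nat \<Rightarrow> real \<Rightarrow> (nat \<Rightarrow> real ^ 'd) \<Rightarrow> real" where
  "flat_marginal n v x = likelihood n v x (sample_mean n x) * sqrt (2 * pi * (v / real n)) ^ CARD('d)"

lemma measurable_flat_marginal [measurable]: "flat_marginal n v \<in> borel_measurable (sample_space n)"
  unfolding flat_marginal_def[abs_def] by measurable

lemma flat_marginal_pos: "v > 0 \<Longrightarrow> n \<ge> 1 \<Longrightarrow> 0 < flat_marginal n v x"
  by (simp add: flat_marginal_def likelihood_def prod_pos iso_normal_density_pos)

text \<open>Sufficiency of the sample mean: by the decomposition of the sum of squares, \<open>\<mu>\<close> enters the
  likelihood through its distance from the sample mean only.\<close>

lemma likelihood_eq_marginal_times_normal:
  fixes x :: "nat \<Rightarrow> real ^ 'd"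
  assumes "n \<ge> 1" "v > 0"
  shows "likelihood n v x \<mu> = flat_marginal n v x * iso_normal_density (sample_mean n x) (v / real n) \<mu>"
proof -
  have lik: "likelihood n v x \<nu>
      = exp (- (\<Sum>i<n. (norm (x i - \<nu>))\<^sup>2) / (2 * v)) / (sqrt (2 * pi * v) ^ CARD('d)) ^ n" for \<nu>
    unfolding likelihood_def iso_normal_density_def prod_dividef
    by (simp add: exp_sum sum_divide_distrib flip: sum_negf)
  have "likelihood n v x \<mu>
      = likelihood n v x (sample_mean n x) * exp (- (real n * (norm (sample_mean n x - \<mu>))\<^sup>2) / (2 * v))"
    unfolding lik sum_norm_sq_about_mean[OF assms(1), of x \<mu>]
    by (simp add: add_divide_distrib diff_divide_distrib exp_add[symmetric])
  then show ?thesis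
    using assms by (simp add: flat_marginal_def iso_normal_density_def norm_minus_commute mult.commute)
qed

text \<open>In the factorization of the likelihood, the marginal cancels in the quotient defining the
  posterior.\<close>

lemma posterior_uniform:
  assumes "n \<ge> 1" "v > 0"
  shows "posterior uniform_prior n v x = iso_normal (sample_mean n x) (v / real n)"
proof -
  let ?c = "ennreal (flat_marginal n v x)" and ?f = "iso_normal_density (sample_mean n x) (v / real n)"
  have v: "v / real n > 0" using assms by simp
  interpret prob_space "iso_normal (sample_mean n x) (v / real n)"
    by (rule prob_space_iso_normal[OF v])
  have c: "0 < flat_marginal n v x" using assms by (simp add: flat_marginal_pos)
  have lik: "ennreal (likelihood n v x \<mu> * uniform_prior \<mu>) = ?c * ennreal (?f \<mu>)" for \<mu>
    using assms c by (simp add: uniform_prior_def likelihood_eq_marginal_times_normal ennreal_mult)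
  have "(\<integral>\<^sup>+\<mu>. ennreal (?f \<mu>) \<partial>lborel) = 1"
    using emeasure_space_1 nn_integral_iso_normal[of "\<lambda>_. 1" "sample_mean n x" "v / real n"] by simp
  then have "(\<integral>\<^sup>+\<mu>. ennreal (likelihood n v x \<mu> * uniform_prior \<mu>) \<partial>lborel) = ?c"
    unfolding lik by (subst nn_integral_cmult) auto
  then show ?thesis
    unfolding posterior_def iso_normal_def using c
    by (intro arg_cong[where f = "density lborel"])
       (simp add: lik fun_eq_iff ennreal_mult_divide_eq mult.commute[of ?c])
qed

lemma nn_integral_iso_normal_reflect:
  fixes a :: "real ^ 'd"
  assumes [measurable]: "f \<in> borel_measurable borel"
  shows "(\<integral>\<^sup>+x. f x \<partial>iso_normal a v) = (\<integral>\<^sup>+z. f (a - z) \<partial>iso_normal 0 v)"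
proof -
  have "(\<integral>\<^sup>+x. f x \<partial>iso_normal a v)
      = (\<integral>\<^sup>+z. ennreal (iso_normal_density a v (a + (-1) *\<^sub>R z)) * f (a + (-1) *\<^sub>R z) \<partial>lborel)"
    unfolding nn_integral_iso_normal[OF assms]
    by (subst nn_integral_lborel_affine[where c = "-1" and t = a]) simp_all
  also have "\<dots> = (\<integral>\<^sup>+z. f (a - z) \<partial>iso_normal 0 v)"
    by (simp add: nn_integral_iso_normal iso_normal_density_def)
  finally show ?thesis .
qed

text \<open>The infinite measure \<open>d\<mu> P\<^sub>\<mu>(dx)\<close> disintegrated the other way round: given the sample, the
  error \<open>z = sample_mean n x - \<mu>\<close> is normal with a law that is the same for all samples.  All
  arguments about priors below are instances of this exchange of integrals.\<close>

lemma nn_integral_flat_joint: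
  fixes G :: "real ^ 'd \<Rightarrow> (nat \<Rightarrow> real ^ 'd) \<Rightarrow> ennreal"
  assumes n: "n \<ge> 1" and v: "v > 0"
    and G [measurable]: "case_prod G \<in> borel_measurable (borel \<Otimes>\<^sub>M sample_space n)"
  shows "(\<integral>\<^sup>+\<mu>. (\<integral>\<^sup>+x. G \<mu> x \<partial>sample_law n \<mu> v) \<partial>lborel)
    = (\<integral>\<^sup>+x. ennreal (flat_marginal n v x) *
        (\<integral>\<^sup>+z. G (sample_mean n x - z) x \<partial>iso_normal 0 (v / real n)) \<partial>sample_lborel n)"
proof -
  note [measurable_cong] = sets_sample_lborel
  interpret S: sigma_finite_measure "sample_lborel n :: (nat \<Rightarrow> real ^ 'd) measure"
    by (rule sigma_finite_sample_lborel)
  interpret P: pair_sigma_finite "sample_lborel n :: (nat \<Rightarrow> real ^ 'd) measure" "lborel :: (real ^ 'd) measure" ..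
  have "(\<integral>\<^sup>+\<mu>. (\<integral>\<^sup>+x. G \<mu> x \<partial>sample_law n \<mu> v) \<partial>lborel)
      = (\<integral>\<^sup>+\<mu>. (\<integral>\<^sup>+x. ennreal (likelihood n v x \<mu>) * G \<mu> x \<partial>sample_lborel n) \<partial>lborel)"
    unfolding sample_law_eq_density[OF v] by (intro nn_integral_cong nn_integral_density) measurable
  also have "\<dots> = (\<integral>\<^sup>+x. (\<integral>\<^sup>+\<mu>. ennreal (likelihood n v x \<mu>) * G \<mu> x \<partial>lborel) \<partial>sample_lborel n)"
    by (rule P.Fubini') measurable
  also have "\<dots> = (\<integral>\<^sup>+x. ennreal (flat_marginal n v x) *
        (\<integral>\<^sup>+\<mu>. G \<mu> x \<partial>iso_normal (sample_mean n x) (v / real n)) \<partial>sample_lborel n)"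
  proof (rule nn_integral_cong)
    fix x :: "nat \<Rightarrow> real ^ 'd" assume "x \<in> space (sample_lborel n)"
    then have x: "x \<in> space (sample_space n)"
      using sets_eq_imp_space_eq[OF sets_sample_lborel] by auto
    have [measurable]: "(\<lambda>\<mu>. G \<mu> x) \<in> borel_measurable borel"
      using measurable_Pair1[OF G x] by simp
    show "(\<integral>\<^sup>+\<mu>. ennreal (likelihood n v x \<mu>) * G \<mu> x \<partial>lborel) = ennreal (flat_marginal n v x) *
        (\<integral>\<^sup>+\<mu>. G \<mu> x \<partial>iso_normal (sample_mean n x) (v / real n))"
      using n v
      by (simp add: nn_integral_iso_normal likelihood_eq_marginal_times_normal ennreal_mult
          flat_marginal_pos less_imp_le mult.assoc nn_integral_cmult)
  qed
  also have "\<dots> = (\<integral>\<^sup>+x. ennreal (flat_marginal n v x) *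
        (\<integral>\<^sup>+z. G (sample_mean n x - z) x \<partial>iso_normal 0 (v / real n)) \<partial>sample_lborel n)"
  proof (rule nn_integral_cong)
    fix x :: "nat \<Rightarrow> real ^ 'd" assume "x \<in> space (sample_lborel n)"
    then have x: "x \<in> space (sample_space n)"
      using sets_eq_imp_space_eq[OF sets_sample_lborel] by auto
    have [measurable]: "(\<lambda>\<mu>. G \<mu> x) \<in> borel_measurable borel"
      using measurable_Pair1[OF G x] by simp
    show "ennreal (flat_marginal n v x) * (\<integral>\<^sup>+\<mu>. G \<mu> x \<partial>iso_normal (sample_mean n x) (v / real n))
      = ennreal (flat_marginal n v x) * (\<integral>\<^sup>+z. G (sample_mean n x - z) x \<partial>iso_normal 0 (v / real n))"
      by (subst nn_integral_iso_normal_reflect) simp_all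
  qed
  finally show ?thesis .
qed

lemma nn_integral_sample_translate:
  fixes \<mu> :: "real ^ 'd"
  assumes v: "v > 0" and [measurable]: "G \<in> borel_measurable (sample_space n)"
  shows "(\<integral>\<^sup>+x. G x \<partial>sample_law n \<mu> v) = (\<integral>\<^sup>+x. G (compose {..<n} ((+) \<mu>) x) \<partial>sample_law n 0 v)"
proof -
  have D: "distr (iso_normal 0 v) borel ((+) \<mu>) = iso_normal \<mu> v"
  proof (rule measure_eqI)
    fix A assume "A \<in> sets (distr (iso_normal 0 v) borel ((+) \<mu>))"
    then have [measurable]: "A \<in> sets borel" by simp
    have "emeasure (distr (iso_normal 0 v) borel ((+) \<mu>)) A
        = (\<integral>\<^sup>+y. indicator A y \<partial>distr (iso_normal 0 v) borel ((+) \<mu>))"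
      by simp
    also have "\<dots> = (\<integral>\<^sup>+x. indicator A (\<mu> + x) \<partial>iso_normal 0 v)"
      by (rule nn_integral_distr) measurable
    also have "\<dots> = (\<integral>\<^sup>+x. indicator A (\<mu> + (0 + sqrt v *\<^sub>R x)) \<partial>iso_normal 0 1)"
      using v by (subst nn_integral_iso_normal_standardize) simp_all
    also have "\<dots> = (\<integral>\<^sup>+x. indicator A x \<partial>iso_normal \<mu> v)"
      using v by (subst (2) nn_integral_iso_normal_standardize) simp_all
    finally show "emeasure (distr (iso_normal 0 v) borel ((+) \<mu>)) A = emeasure (iso_normal \<mu> v) A"
      by simp
  qed simp
  have [measurable]: "compose {..<n} ((+) \<mu>) \<in> sample_space n \<rightarrow>\<^sub>M sample_space n"
    unfolding sample_space_def compose_def by (intro measurable_restrict) simp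
  have "sample_law n \<mu> v
      = distr (sample_law n 0 v) (sample_law n 0 v) (compose {..<n} ((+) \<mu>))"
    unfolding sample_law_def
    by (subst distr_PiM_finite_prob_space')
       (auto intro: prob_space_iso_normal[OF v] simp flip: D cong: distr_cong)
  then show ?thesis by (simp add: nn_integral_distr)
qed

lemma sample_mean_translate:
  "n \<ge> 1 \<Longrightarrow> sample_mean n (compose {..<n} ((+) \<mu>) x) = \<mu> + sample_mean n x"
  by (simp add: sample_mean_def compose_def sum.distrib sum_constant_scaleR scaleR_add_right del: sum_constant)

text \<open>Under the flat prior the sample mean itself is spread according to Lebesgue measure: integrating
  over \<open>\<mu>\<close> first, translation invariance removes the sample from the integral.\<close>

lemma nn_integral_flat_marginal_mean:
  fixes g :: "real ^ 'd \<Rightarrow> ennreal"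
  assumes n: "n \<ge> 1" and v: "v > 0" and g [measurable]: "g \<in> borel_measurable borel"
  shows "(\<integral>\<^sup>+x. ennreal (flat_marginal n v x) * g (sample_mean n x) \<partial>sample_lborel n)
    = (\<integral>\<^sup>+y. g y \<partial>lborel)"
proof -
  have v': "v / real n > 0" using n v by simp
  interpret N: prob_space "iso_normal (0 :: real ^ 'd) (v / real n)" by (rule prob_space_iso_normal[OF v'])
  interpret S: prob_space "sample_law n (0 :: real ^ 'd) v" by (rule prob_space_sample_law[OF v])
  interpret P: pair_sigma_finite "sample_law n (0 :: real ^ 'd) v" "lborel :: (real ^ 'd) measure" ..
  have "(\<integral>\<^sup>+x. ennreal (flat_marginal n v x) * g (sample_mean n x) \<partial>sample_lborel n)
      = (\<integral>\<^sup>+\<mu>. (\<integral>\<^sup>+x. g (sample_mean n x) \<partial>sample_law n \<mu> v) \<partial>lborel)"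
    using n v N.emeasure_space_1 by (subst nn_integral_flat_joint) simp_all
  also have "\<dots> = (\<integral>\<^sup>+\<mu>. (\<integral>\<^sup>+x. g (\<mu> + sample_mean n x) \<partial>sample_law n 0 v) \<partial>lborel)"
    using n v by (subst nn_integral_sample_translate) (simp_all add: sample_mean_translate)
  also have "\<dots> = (\<integral>\<^sup>+x. (\<integral>\<^sup>+\<mu>. g (\<mu> + sample_mean n x) \<partial>lborel) \<partial>sample_law n 0 v)"
    by (rule P.Fubini') measurable
  also have "\<dots> = (\<integral>\<^sup>+x. (\<integral>\<^sup>+\<mu>. g \<mu> \<partial>lborel) \<partial>sample_law n (0 :: real ^ 'd) v)"
  proof (rule nn_integral_cong)
    fix x :: "nat \<Rightarrow> real ^ 'd"
    show "(\<integral>\<^sup>+\<mu>. g (\<mu> + sample_mean n x) \<partial>lborel) = (\<integral>\<^sup>+\<mu>. g \<mu> \<partial>lborel)"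
      using nn_integral_lborel_affine[OF g, of 1 "sample_mean n x"] by (simp add: add.commute)
  qed
  also have "\<dots> = (\<integral>\<^sup>+y. g y \<partial>lborel)"
    using S.emeasure_space_1 by simp
  finally show ?thesis .
qed

text \<open>The law of \<open>sample_mean n x - \<mu>\<close> without convolutions.  By translation it does not depend on \<open>\<mu>\<close>,
  hence it equals its average over \<open>\<mu>\<close> with respect to a probability density \<open>g\<close>.  Exchanging the
  integrals, the error becomes normal given the sample, and the total weight of \<open>g\<close> against
  the marginal law of the sample mean is \<open>1\<close>.\<close>

lemma nn_integral_sample_mean:
  fixes \<mu> :: "real ^ 'd" and f :: "real ^ 'd \<Rightarrow> ennreal"
  assumes n: "n \<ge> 1" and v: "v > 0" and f [measurable]: "f \<in> borel_measurable borel"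
  shows "(\<integral>\<^sup>+x. f (sample_mean n x - \<mu>) \<partial>sample_law n \<mu> v) = (\<integral>\<^sup>+z. f z \<partial>iso_normal 0 (v / real n))"
proof -
  note [measurable_cong] = sets_sample_lborel
  \<comment> \<open>The average over \<open>\<mu>\<close> may be taken with respect to any probability density; the unit cube is one.\<close>
  define g :: "real ^ 'd \<Rightarrow> ennreal" where "g = indicator (cbox 0 One)"
  have [measurable]: "g \<in> borel_measurable borel" unfolding g_def by simp
  have g1: "(\<integral>\<^sup>+\<mu>. g \<mu> \<partial>lborel) = 1" unfolding g_def by (simp add: emeasure_lborel_cbox_eq)
  have g1': "(\<integral>\<^sup>+\<mu>. g (\<mu> - z) \<partial>lborel) = 1" for z
    using nn_integral_lborel_affine[of g 1 "-z"] g1 by simp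
  have v': "v / real n > 0" using n v by simp
  interpret N: prob_space "iso_normal (0 :: real ^ 'd) (v / real n)" by (rule prob_space_iso_normal[OF v'])
  interpret S: sigma_finite_measure "sample_lborel n :: (nat \<Rightarrow> real ^ 'd) measure"
    by (rule sigma_finite_sample_lborel)
  interpret P: pair_sigma_finite "sample_lborel n :: (nat \<Rightarrow> real ^ 'd) measure"
    "iso_normal (0 :: real ^ 'd) (v / real n)" ..
  let ?c = "\<integral>\<^sup>+x. f (sample_mean n x) \<partial>sample_law n 0 v"
  have tr: "(\<integral>\<^sup>+x. f (sample_mean n x - \<mu>) \<partial>sample_law n \<mu> v) = ?c" for \<mu> :: "real ^ 'd"
    using n v by (subst nn_integral_sample_translate) (simp_all add: sample_mean_translate)
  have "?c = (\<integral>\<^sup>+\<mu>. (\<integral>\<^sup>+x. g \<mu> * f (sample_mean n x - \<mu>) \<partial>sample_law n \<mu> v) \<partial>lborel)"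
    by (simp add: nn_integral_cmult tr nn_integral_multc g1)
  also have "\<dots> = (\<integral>\<^sup>+x. ennreal (flat_marginal n v x) *
        (\<integral>\<^sup>+z. g (sample_mean n x - z) * f z \<partial>iso_normal 0 (v / real n)) \<partial>sample_lborel n)"
    using n v by (subst nn_integral_flat_joint) simp_all
  also have "\<dots> = (\<integral>\<^sup>+x. (\<integral>\<^sup>+z. f z * (ennreal (flat_marginal n v x) * g (sample_mean n x - z))
        \<partial>iso_normal 0 (v / real n)) \<partial>sample_lborel n)"
    by (intro nn_integral_cong, subst nn_integral_cmult[symmetric], measurable) (simp add: mult_ac)
  also have "\<dots> = (\<integral>\<^sup>+z. (\<integral>\<^sup>+x. f z * (ennreal (flat_marginal n v x) * g (sample_mean n x - z))
        \<partial>sample_lborel n) \<partial>iso_normal 0 (v / real n))"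
    by (rule P.Fubini'[symmetric]) measurable
  also have "\<dots> = (\<integral>\<^sup>+z. f z \<partial>iso_normal 0 (v / real n))"
  proof (rule nn_integral_cong)
    fix z :: "real ^ 'd"
    have "(\<integral>\<^sup>+x. f z * (ennreal (flat_marginal n v x) * g (sample_mean n x - z)) \<partial>sample_lborel n)
        = f z * (\<integral>\<^sup>+x. ennreal (flat_marginal n v x) * g (sample_mean n x - z) \<partial>sample_lborel n)"
      by (rule nn_integral_cmult) measurable
    also have "\<dots> = f z"
      using nn_integral_flat_marginal_mean[OF n v, of "\<lambda>y. g (y - z)"] by (simp add: g1')
    finally show "(\<integral>\<^sup>+x. f z * (ennreal (flat_marginal n v x) * g (sample_mean n x - z)) \<partial>sample_lborel n) = f z" .
  qed
  finally show ?thesis by (simp add: tr)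
qed

section \<open>A lower bound for location problems\<close>

text \<open>For a loss that depends on \<open>\<mu>\<close> only through the error of the sample mean, put the uniform prior on
  the ball of radius \<open>k\<close>.  If the sample mean is within \<open>k - M\<close> of the origin, every \<open>\<mu>\<close> that makes the
  error at most \<open>M\<close> lies in the ball, so the posterior loss restricted to those \<open>\<mu>\<close> is the one of the
  flat prior, which is at least \<open>r\<close> times the marginal density.  The excluded samples carry a
  fraction of the total mass that vanishes as \<open>k\<close> tends to infinity.\<close>

lemma location_risk_lower_bound:
  fixes h :: "real ^ 'd \<Rightarrow> real \<Rightarrow> ennreal" and \<delta> :: "(nat \<Rightarrow> real ^ 'd) \<Rightarrow> real"
  assumes n: "n \<ge> 1" and v: "v > 0" and M: "M \<ge> 0" and r: "r < \<infinity>"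
    and h [measurable]: "case_prod h \<in> borel_measurable (borel \<Otimes>\<^sub>M borel)"
    and \<delta> [measurable]: "\<delta> \<in> borel_measurable (sample_space n)"
    and lower: "\<And>x. x \<in> space (sample_space n) \<Longrightarrow>
      r \<le> (\<integral>\<^sup>+z. h z (\<delta> x) * indicator (cball 0 M) z \<partial>iso_normal 0 (v / real n))"
    and upper: "\<And>\<mu>. (\<integral>\<^sup>+x. h (sample_mean n x - \<mu>) (\<delta> x) \<partial>sample_law n \<mu> v) \<le> S"
  shows "r \<le> S"
proof -
  note [measurable_cong] = sets_sample_lborel
  have cball [measurable]: "cball (0 :: real ^ 'd) k \<in> sets borel" for k by simp
  let ?\<omega> = "unit_ball_vol (real CARD('d))"
  have vol: "emeasure lborel (cball (0 :: real ^ 'd) k) = ennreal (?\<omega> * k ^ CARD('d))" if "k \<ge> 0" for k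
    using emeasure_cball[OF that, of "0 :: real ^ 'd"] by simp
  have \<omega>: "?\<omega> > 0" by (simp add: unit_ball_vol_pos)
  then have \<omega>0: "?\<omega> \<noteq> 0" by linarith
  \<comment> \<open>Cancelling the volumes of the balls of radius \<open>k - M\<close> and \<open>k\<close> leaves the ratio of their radii.\<close>
  have avg: "r * ennreal (((k - M) / k) ^ CARD('d)) \<le> S" if k: "k > M" "k > 0" for k
  proof -
    have "r * emeasure lborel (cball (0 :: real ^ 'd) (k - M))
        = (\<integral>\<^sup>+x. ennreal (flat_marginal n v x) * (r * indicator (cball (0 :: real ^ 'd) (k - M)) (sample_mean n x))
            \<partial>sample_lborel n)"
      by (subst nn_integral_flat_marginal_mean[OF n v], measurable)
         (simp add: nn_integral_cmult_indicator)
    also have "\<dots> \<le> (\<integral>\<^sup>+x. ennreal (flat_marginal n v x) *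
        (\<integral>\<^sup>+z. indicator (cball 0 k) (sample_mean n x - z) * h z (\<delta> x) \<partial>iso_normal 0 (v / real n))
          \<partial>sample_lborel n)"
    proof (intro nn_integral_mono mult_left_mono)
      fix x :: "nat \<Rightarrow> real ^ 'd" assume "x \<in> space (sample_lborel n)"
      then have x: "x \<in> space (sample_space n)"
        using sets_eq_imp_space_eq[OF sets_sample_lborel] by auto
      show "r * indicator (cball 0 (k - M)) (sample_mean n x)
          \<le> (\<integral>\<^sup>+z. indicator (cball 0 k) (sample_mean n x - z) * h z (\<delta> x) \<partial>iso_normal 0 (v / real n))"
      proof (cases "sample_mean n x \<in> cball 0 (k - M)")
        case True
        have "r \<le> (\<integral>\<^sup>+z. h z (\<delta> x) * indicator (cball 0 M) z \<partial>iso_normal 0 (v / real n))"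
          by (rule lower[OF x])
        also have "\<dots> \<le> (\<integral>\<^sup>+z. indicator (cball 0 k) (sample_mean n x - z) * h z (\<delta> x) \<partial>iso_normal 0 (v / real n))"
        proof (rule nn_integral_mono)
          fix z :: "real ^ 'd"
          have "norm (sample_mean n x - z) \<le> k" if "norm z \<le> M"
            using True that norm_triangle_ineq4[of "sample_mean n x" z] by simp
          then show "h z (\<delta> x) * indicator (cball 0 M) z
              \<le> indicator (cball 0 k) (sample_mean n x - z) * h z (\<delta> x)"
            by (auto simp: indicator_def)
        qed
        finally show ?thesis using True by simp
      qed simp
    qed simp
    also have "\<dots> = (\<integral>\<^sup>+\<mu>. (\<integral>\<^sup>+x. indicator (cball 0 k) \<mu> * h (sample_mean n x - \<mu>) (\<delta> x) \<partial>sample_law n \<mu> v) \<partial>lborel)"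
      using n v by (subst nn_integral_flat_joint) simp_all
    also have "\<dots> \<le> (\<integral>\<^sup>+\<mu>. S * indicator (cball 0 k) (\<mu> :: real ^ 'd) \<partial>lborel)"
      using upper by (intro nn_integral_mono) (auto simp: indicator_def)
    also have "\<dots> = S * emeasure lborel (cball (0 :: real ^ 'd) k)"
      by (simp add: nn_integral_cmult_indicator)
    finally have le: "r * ennreal (?\<omega> * (k - M) ^ CARD('d)) \<le> S * ennreal (?\<omega> * k ^ CARD('d))"
      using k M by (simp add: vol)
    have "r * ennreal (((k - M) / k) ^ CARD('d))
        = r * ennreal (?\<omega> * (k - M) ^ CARD('d)) * ennreal (1 / (?\<omega> * k ^ CARD('d)))"
      using k M \<omega> \<omega>0 by (simp add: mult.assoc power_divide flip: ennreal_mult)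
    also have "\<dots> \<le> S * ennreal (?\<omega> * k ^ CARD('d)) * ennreal (1 / (?\<omega> * k ^ CARD('d)))"
      by (rule mult_right_mono[OF le]) simp
    also have "\<dots> = S"
      using k M \<omega> \<omega>0 by (simp add: mult.assoc flip: ennreal_mult)
    finally show ?thesis .
  qed
  have "((\<lambda>k. (1 - M / k) ^ CARD('d)) \<longlongrightarrow> (1 - 0) ^ CARD('d)) at_top"
    by (intro tendsto_intros tendsto_divide_0[OF tendsto_const] filterlim_at_top_imp_at_infinity
        filterlim_ident)
  then have "((\<lambda>k. r * ennreal ((1 - M / k) ^ CARD('d))) \<longlongrightarrow> r * ennreal ((1 - 0) ^ CARD('d))) at_top"
    using r by (intro ennreal_tendsto_cmult tendsto_ennrealI) simp_all
  then have "((\<lambda>k. r * ennreal ((1 - M / k) ^ CARD('d))) \<longlongrightarrow> r) at_top" by simp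
  moreover have "eventually (\<lambda>k. r * ennreal ((1 - M / k) ^ CARD('d)) \<le> S) at_top"
    using eventually_gt_at_top[of M] eventually_gt_at_top[of 0]
    by eventually_elim (use avg in \<open>simp add: diff_divide_distrib\<close>)
  ultimately show ?thesis
    by (rule tendsto_upperbound) simp
qed

section \<open>Truncated risks\<close>

text \<open>Passing to the infimum over \<open>l\<close> commutes with exhausting the probability space.  Otherwise there
  are \<open>l k\<close> whose risks on \<open>A k\<close> are at most \<open>q < r\<close>.  On the compact interval \<open>[0,\<infinity>]\<close> a subsequence
  converges, and by Fatou's lemma the limit has risk at most \<open>q\<close>: at an interior limit this contradicts the
  lower bound for the full risk, at an end point the lower bound for the limit of \<open>\<rho>\<close>.\<close>

lemma truncated_risk_recovers_infimum:
  fixes L :: "'a \<Rightarrow> real" and \<rho> :: "real \<Rightarrow> real" and A :: "nat \<Rightarrow> 'a set"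
  assumes M: "prob_space M" and L [measurable]: "L \<in> borel_measurable M"
    and A [measurable]: "\<And>k. A k \<in> sets M"
    and \<rho> [measurable]: "\<rho> \<in> borel_measurable borel"
    and Lpos: "AE x in M. 0 < L x"
    and exhaust: "AE x in M. eventually (\<lambda>k. x \<in> A k) sequentially"
    and cont: "\<And>t. t > 0 \<Longrightarrow> isCont \<rho> t"
    and at_zero: "((\<lambda>t. ennreal (\<rho> t)) \<longlongrightarrow> e0) (at_right 0)" "r \<le> e0"
    and at_inf: "((\<lambda>t. ennreal (\<rho> t)) \<longlongrightarrow> e1) at_top" "r \<le> e1"
    and level: "\<And>l. l > 0 \<Longrightarrow> r \<le> (\<integral>\<^sup>+x. ennreal (\<rho> (l / L x)) \<partial>M)"
    and q: "q < r"
  shows "\<exists>k. \<forall>l>0. q < (\<integral>\<^sup>+x. ennreal (\<rho> (l / L x)) * indicator (A k) x \<partial>M)"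
proof (rule ccontr)
  interpret prob_space M by fact
  assume "\<not> ?thesis"
  then have "\<forall>k. \<exists>l>0. (\<integral>\<^sup>+x. ennreal (\<rho> (l / L x)) * indicator (A k) x \<partial>M) \<le> q"
    by (auto simp: not_less)
  then obtain l where l: "\<And>k. l k > 0"
    and lq: "\<And>k. (\<integral>\<^sup>+x. ennreal (\<rho> (l k / L x)) * indicator (A k) x \<partial>M) \<le> q"
    by metis
  \<comment> \<open>On the logarithmic scale the interval \<open>[0,\<infinity>]\<close> becomes the extended real line.\<close>
  obtain \<Lambda> s where s: "strict_mono s" and lim: "((\<lambda>k. ereal (ln (l k))) \<circ> s) \<longlonglongrightarrow> \<Lambda>"
    using compact_complete_linorder[of "\<lambda>k. ereal (ln (l k))"] by blast
  define l' where "l' k = l (s k)" for k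
  have l': "l' k > 0" for k using l by (simp add: l'_def)
  have l'_exp: "l' = (\<lambda>k. exp (ln (l' k)))" using l' by simp
  have lim': "(\<lambda>k. ereal (ln (l' k))) \<longlonglongrightarrow> \<Lambda>" using lim by (simp add: l'_def comp_def)
  let ?f = "\<lambda>k x. ennreal (\<rho> (l' k / L x)) * indicator (A (s k)) x"
  have eventually_in: "AE x in M. eventually (\<lambda>k. x \<in> A (s k)) sequentially"
    using exhaust by eventually_elim (rule eventually_subseq[OF s])
  have lower: "AE x in M. e x \<le> liminf (\<lambda>k. ?f k x)"
    if "\<And>x. 0 < L x \<Longrightarrow> (\<lambda>k. ennreal (\<rho> (l' k / L x))) \<longlonglongrightarrow> e x" for e
    using Lpos eventually_in
  proof eventually_elim
    case (elim x)
    have "eventually (\<lambda>k. ennreal (\<rho> (l' k / L x)) = ?f k x) sequentially"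
      using elim(2) by eventually_elim simp
    then have "(\<lambda>k. ?f k x) \<longlonglongrightarrow> e x"
      using that[OF elim(1)] by (rule Lim_transform_eventually[rotated])
    then show ?case by (simp add: lim_imp_Liminf)
  qed
  have "r \<le> (\<integral>\<^sup>+x. liminf (\<lambda>k. ?f k x) \<partial>M)"
  proof (cases \<Lambda>)
    case (real a)
    then have "(\<lambda>k. ln (l' k)) \<longlonglongrightarrow> a" using lim' by simp
    then have "l' \<longlonglongrightarrow> exp a" by (subst l'_exp) (rule tendsto_exp)
    then have "(\<lambda>k. ennreal (\<rho> (l' k / L x))) \<longlonglongrightarrow> ennreal (\<rho> (exp a / L x))" if "0 < L x" for x
      using that by (intro tendsto_ennrealI isCont_tendsto_compose[OF cont] tendsto_divide tendsto_const) auto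
    then have "(\<integral>\<^sup>+x. ennreal (\<rho> (exp a / L x)) \<partial>M) \<le> (\<integral>\<^sup>+x. liminf (\<lambda>k. ?f k x) \<partial>M)"
      by (intro nn_integral_mono_AE lower)
    with level[of "exp a"] show ?thesis by simp
  next
    case PInf
    then have "filterlim (\<lambda>k. ln (l' k)) at_top sequentially"
      using lim' by (simp add: tendsto_PInfty_eq_at_top)
    then have "filterlim l' at_top sequentially"
      by (subst l'_exp) (rule filterlim_compose[OF exp_at_top])
    then have "filterlim (\<lambda>k. l' k / L x) at_top sequentially" if "0 < L x" for x
      using that unfolding divide_inverse
      by (intro filterlim_at_top_mult_tendsto_pos[OF tendsto_const]) simp_all
    then have "(\<lambda>k. ennreal (\<rho> (l' k / L x))) \<longlonglongrightarrow> e1" if "0 < L x" for x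
      using that by (intro filterlim_compose[OF at_inf(1)])
    then have "(\<integral>\<^sup>+x. e1 \<partial>M) \<le> (\<integral>\<^sup>+x. liminf (\<lambda>k. ?f k x) \<partial>M)"
      by (intro nn_integral_mono_AE lower)
    with at_inf(2) show ?thesis by (simp add: emeasure_space_1)
  next
    case MInf
    then have "filterlim (\<lambda>k. ln (l' k)) at_bot sequentially"
      using lim' by (simp add: tendsto_MInfty filterlim_at_bot_dense)
    then have "l' \<longlonglongrightarrow> 0"
      by (subst l'_exp) (rule filterlim_compose[OF exp_at_bot])
    then have "(\<lambda>k. l' k / L x) \<longlonglongrightarrow> 0" for x
      using tendsto_mult_left_zero[of l' sequentially "inverse (L x)"] by (simp add: divide_inverse)
    then have "filterlim (\<lambda>k. l' k / L x) (at_right 0) sequentially" if "0 < L x" for x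
      using that l' by (simp add: filterlim_at less_imp_neq[symmetric])
    then have "(\<lambda>k. ennreal (\<rho> (l' k / L x))) \<longlonglongrightarrow> e0" if "0 < L x" for x
      using that by (intro filterlim_compose[OF at_zero(1)])
    then have "(\<integral>\<^sup>+x. e0 \<partial>M) \<le> (\<integral>\<^sup>+x. liminf (\<lambda>k. ?f k x) \<partial>M)"
      by (intro nn_integral_mono_AE lower)
    with at_zero(2) show ?thesis by (simp add: emeasure_space_1)
  qed
  also have "\<dots> \<le> liminf (\<lambda>k. \<integral>\<^sup>+x. ?f k x \<partial>M)"
    by (rule nn_integral_liminf) measurable
  also have "\<dots> \<le> q"
    using lq by (intro Liminf_le always_eventually) (auto simp: l'_def)
  finally show False using q by simp
qed

section \<open>The four loss functions\<close>

text \<open>In terms of \<open>s = l powr m\<close>, the loss is the strictly convex function \<open>(s * b powr (-m) - 1)\<^sup>2\<close>; the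
  witness is the midpoint on that scale.\<close>

lemma midpoint_rho_A:
  fixes l l' :: real
  assumes m: "m \<noteq> 0" and l: "l > 0" "l' > 0" "l \<noteq> l'"
  shows "\<exists>k>0. \<forall>b>0. 2 * rho_A m (k / b) < rho_A m (l / b) + rho_A m (l' / b)"
proof (intro exI conjI allI impI)
  let ?s = "(l powr m + l' powr m) / 2"
  have s: "?s > 0" using l by (simp add: add_pos_pos)
  then show "?s powr (1 / m) > 0" by simp
  fix b :: real assume b: "b > 0"
  define u u' where "u = l powr m / b powr m" and "u' = l' powr m / b powr m"
  have k: "(?s powr (1 / m) / b) powr m = (u + u') / 2"
    using s b m by (simp add: powr_divide powr_powr u_def u'_def add_divide_distrib)
  have "l powr m \<noteq> l' powr m"
  proof
    assume "l powr m = l' powr m"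
    then have "(l powr m) powr (1 / m) = (l' powr m) powr (1 / m)" by simp
    then show False using l m by (simp add: powr_powr)
  qed
  then have "u \<noteq> u'" using b by (simp add: u_def u'_def)
  then have "(u - u')\<^sup>2 > 0" by simp
  moreover have "2 * ((u + u') / 2 - 1)\<^sup>2 + (u - u')\<^sup>2 / 2 = (u - 1)\<^sup>2 + (u' - 1)\<^sup>2"
    by (simp add: power2_eq_square field_simps)
  ultimately have "2 * ((u + u') / 2 - 1)\<^sup>2 < (u - 1)\<^sup>2 + (u' - 1)\<^sup>2" by linarith
  then show "2 * rho_A m (?s powr (1 / m) / b) < rho_A m (l / b) + rho_A m (l' / b)"
    unfolding rho_A_def k using l b by (simp add: powr_divide u_def u'_def)
qed

text \<open>Here the loss is strictly convex in \<open>l\<close> itself, because \<open>1 / l\<close> is.\<close>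

lemma midpoint_rho_B:
  fixes l l' :: real
  assumes l: "l > 0" "l' > 0" "l \<noteq> l'"
  shows "\<exists>k>0. \<forall>b>0. 2 * rho_B (k / b) < rho_B (l / b) + rho_B (l' / b)"
proof (intro exI conjI allI impI)
  show "(l + l') / 2 > 0" using l by simp
  fix b :: real assume b: "b > 0"
  define p p' where "p = l / b" and "p' = l' / b"
  have p: "p > 0" "p' > 0" "p \<noteq> p'" using l b by (simp_all add: p_def p'_def)
  then have "(p - p')\<^sup>2 > 0" by simp
  then have "4 * (p * p') < (p + p') * (p + p')" by (simp add: power2_eq_square algebra_simps)
  then have lt: "4 / (p + p') < 1 / p + 1 / p'"
    using p by (simp add: field_simps add_pos_pos)
  define s where "s = p + p'"
  have "4 / s < 1 / p + 1 / p'" using lt by (simp add: s_def)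
  moreover have "2 * rho_B (s / 2) = s / 2 + 2 / s - 2" by (simp add: rho_B_def)
  moreover have "rho_B p + rho_B p' = (s + (1 / p + 1 / p') - 4) / 2"
    by (simp add: rho_B_def s_def add_divide_distrib diff_divide_distrib)
  ultimately have "2 * rho_B (s / 2) < rho_B p + rho_B p'" by (simp add: diff_divide_distrib add_divide_distrib)
  moreover have "(l + l') / 2 / b = s / 2"
    by (simp add: p_def p'_def s_def add_divide_distrib)
  ultimately show "2 * rho_B ((l + l') / 2 / b) < rho_B (l / b) + rho_B (l' / b)"
    by (simp only: p_def p'_def)
qed

text \<open>Here the loss is strictly convex in \<open>ln l\<close>, so the witness is the geometric mean.\<close>

lemma midpoint_rho_C:
  fixes l l' :: real
  assumes l: "l > 0" "l' > 0" "l \<noteq> l'"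
  shows "\<exists>k>0. \<forall>b>0. 2 * rho_C (k / b) < rho_C (l / b) + rho_C (l' / b)"
proof (intro exI conjI allI impI)
  show "sqrt (l * l') > 0" using l by simp
  fix b :: real assume b: "b > 0"
  define u u' where "u = ln (l / b)" and "u' = ln (l' / b)"
  have k: "ln (sqrt (l * l') / b) = (u + u') / 2"
    using l b by (simp add: u_def u'_def ln_div ln_sqrt ln_mult field_simps)
  have "u \<noteq> u'" using l b by (simp add: u_def u'_def)
  then have "(u - u')\<^sup>2 > 0" by simp
  moreover have "2 * ((u + u') / 2)\<^sup>2 + (u - u')\<^sup>2 / 2 = u\<^sup>2 + u'\<^sup>2"
    by (simp add: power2_eq_square field_simps)
  ultimately have "2 * ((u + u') / 2)\<^sup>2 < u\<^sup>2 + u'\<^sup>2" by linarith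
  then show "2 * rho_C (sqrt (l * l') / b) < rho_C (l / b) + rho_C (l' / b)"
    by (simp add: rho_C_def k u_def u'_def)
qed

lemma measurable_losses [measurable]:
  "rho m \<in> borel_measurable borel" "rho_A m \<in> borel_measurable borel"
  "rho_B \<in> borel_measurable borel" "rho_C \<in> borel_measurable borel"
  unfolding rho_def[abs_def] rho_A_def[abs_def] rho_B_def[abs_def] rho_C_def[abs_def] by measurable

lemma isCont_losses:
  assumes "t > 0"
  shows "isCont (rho m) t" "isCont (rho_A m) t" "isCont rho_B t" "isCont rho_C t"
  unfolding rho_def[abs_def] rho_A_def[abs_def] rho_B_def[abs_def] rho_C_def[abs_def]
  by (intro continuous_intros; use assms in simp)+

text \<open>The variable \<open>y = m * ln t\<close> turns \<open>rho m t\<close> into \<open>exp y - y - 1\<close>, which grows at least linearly in both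
  directions.\<close>

lemma rho_ge_log: "t > 0 \<Longrightarrow> rho m t \<ge> \<bar>m\<bar> * \<bar>ln t\<bar> - 1"
proof -
  assume t: "t > 0"
  define y where "y = m * ln t"
  have "exp y - y - 1 \<ge> \<bar>y\<bar> - 1"
  proof (cases "y \<ge> 0")
    case True
    have "1 + y + y\<^sup>2 / 2 \<le> exp y" by (rule exp_lower_Taylor_quadratic[OF True])
    moreover have "(y - 1)\<^sup>2 \<ge> 0" by simp
    ultimately show ?thesis using True by (simp add: power2_eq_square algebra_simps)
  qed simp
  then show ?thesis using t by (simp add: rho_def y_def powr_def abs_mult mult.commute)
qed

lemma rho_B_ge_log: "t > 0 \<Longrightarrow> rho_B t \<ge> \<bar>ln t\<bar> - 1"
proof -
  assume t: "t > 0"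
  \<comment> \<open>The logarithms of the two losses cancel.\<close>
  have "2 * rho_B t = rho 1 t + rho (-1) t"
    using t by (simp add: rho_B_def rho_def powr_minus_divide)
  then show ?thesis using rho_ge_log[OF t, of 1] rho_ge_log[OF t, of "-1"] by simp
qed

lemma rho_nonneg: "t > 0 \<Longrightarrow> rho m t \<ge> 0"
  using exp_ge_add_one_self[of "m * ln t"] unfolding rho_def powr_def by (simp del: exp_ge_add_one_self)

lemma rho_B_nonneg: "t > 0 \<Longrightarrow> rho_B t \<ge> 0"
  using rho_nonneg[of t 1] rho_nonneg[of t "-1"] by (simp add: rho_B_def rho_def powr_minus_divide)

lemma rho_C_ge_log: "t > 0 \<Longrightarrow> rho_C t \<ge> \<bar>ln t\<bar> - 1"
proof -
  have "(\<bar>ln t\<bar> - 1)\<^sup>2 + \<bar>ln t\<bar> \<ge> 0" by simp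
  moreover have "(\<bar>ln t\<bar> - 1)\<^sup>2 = (ln t)\<^sup>2 - 2 * \<bar>ln t\<bar> + 1"
    by (simp add: power2_diff)
  ultimately show ?thesis by (simp add: rho_C_def)
qed

text \<open>A bound of this kind holds for \<open>rho m\<close>, \<open>rho_B\<close> and \<open>rho_C\<close>, but not for \<open>rho_A m\<close>.\<close>

lemma coercive_in_log_tendsto_top:
  fixes \<rho> :: "real \<Rightarrow> real"
  assumes a: "a > 0" and ge: "\<And>t. t > 0 \<Longrightarrow> \<rho> t \<ge> a * \<bar>ln t\<bar> - 1"
  shows "((\<lambda>t. ennreal (\<rho> t)) \<longlongrightarrow> \<top>) (at_right 0)" and "((\<lambda>t. ennreal (\<rho> t)) \<longlongrightarrow> \<top>) at_top"
proof -
  have *: "((\<lambda>t. ennreal (\<rho> t)) \<longlongrightarrow> \<top>) F"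
    if F: "filterlim ln at_infinity F" and pos: "eventually (\<lambda>t. t > 0) F" for F :: "real filter"
  proof -
    have "filterlim (\<lambda>t. \<bar>ln t\<bar>) at_top F"
      using filterlim_at_infinity_imp_norm_at_top[OF F] by simp
    then have "filterlim (\<lambda>t. -1 + a * \<bar>ln t\<bar>) at_top F"
      using a by (intro filterlim_tendsto_add_at_top[OF tendsto_const]
          filterlim_tendsto_pos_mult_at_top[OF tendsto_const])
    then have "filterlim \<rho> at_top F"
      by (rule filterlim_at_top_mono) (use pos ge in \<open>auto elim!: eventually_mono\<close>)
    then show ?thesis by (simp add: ennreal_tendsto_top_eq_at_top)
  qed
  show "((\<lambda>t. ennreal (\<rho> t)) \<longlongrightarrow> \<top>) (at_right 0)"
    by (rule *) (auto intro: filterlim_at_bot_imp_at_infinity ln_at_0 simp: eventually_at_right_less)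
  show "((\<lambda>t. ennreal (\<rho> t)) \<longlongrightarrow> \<top>) at_top"
    by (rule *) (auto intro: filterlim_at_top_imp_at_infinity ln_at_top eventually_gt_at_top)
qed

text \<open>As \<open>t\<close> tends to \<open>0\<close> or to infinity, \<open>t powr m\<close> tends to \<open>0\<close> at one of these ends and to infinity at
  the other; in the first case \<open>rho_A m t\<close> tends to \<open>1\<close>.  The value \<open>1\<close> is the reason for
  \<open>constant_risk_rho_A_le_1\<close> below.\<close>

lemma rho_A_limits:
  assumes m: "m \<noteq> 0"
  obtains e0 e1 where "((\<lambda>t. ennreal (rho_A m t)) \<longlongrightarrow> e0) (at_right 0)" "1 \<le> e0"
    and "((\<lambda>t. ennreal (rho_A m t)) \<longlongrightarrow> e1) at_top" "1 \<le> e1"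
proof -
  have eq: "eventually (\<lambda>t. ennreal ((exp (m * ln t) - 1)\<^sup>2) = ennreal (rho_A m t)) F"
    if "eventually (\<lambda>t. t > 0) F" for F
    using that by eventually_elim (simp add: rho_A_def powr_def)
  have bot: "((\<lambda>t. ennreal (rho_A m t)) \<longlongrightarrow> 1) F"
    if F: "filterlim (\<lambda>t. m * ln t) at_bot F" and pos: "eventually (\<lambda>t. t > 0) F" for F
  proof -
    have "((\<lambda>t. exp (m * ln t)) \<longlongrightarrow> 0) F" by (rule filterlim_compose[OF exp_at_bot F])
    then have "((\<lambda>t. ennreal ((exp (m * ln t) - 1)\<^sup>2)) \<longlongrightarrow> ennreal ((0 - 1)\<^sup>2)) F"
      by (intro tendsto_intros)
    then show ?thesis using Lim_transform_eventually[OF _ eq[OF pos]] by simp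
  qed
  have top: "((\<lambda>t. ennreal (rho_A m t)) \<longlongrightarrow> \<top>) F"
    if F: "filterlim (\<lambda>t. m * ln t) at_top F" and pos: "eventually (\<lambda>t. t > 0) F" for F
  proof -
    have "filterlim (\<lambda>t. exp (m * ln t)) at_top F" by (rule filterlim_compose[OF exp_at_top F])
    then have "filterlim (\<lambda>t. -1 + exp (m * ln t)) at_top F"
      by (rule filterlim_tendsto_add_at_top[OF tendsto_const])
    then have "filterlim (\<lambda>t. exp (m * ln t) - 1) at_top F" by simp
    then have "filterlim (\<lambda>t. (exp (m * ln t) - 1)\<^sup>2) at_top F"
      by (rule filterlim_pow_at_top[rotated]) simp
    then have "((\<lambda>t. ennreal ((exp (m * ln t) - 1)\<^sup>2)) \<longlongrightarrow> \<top>) F"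
      by (simp add: ennreal_tendsto_top_eq_at_top)
    then show ?thesis by (rule Lim_transform_eventually[OF _ eq[OF pos]])
  qed
  have pos0: "eventually (\<lambda>t :: real. t > 0) (at_right 0)" by (rule eventually_at_right_less)
  have pos1: "eventually (\<lambda>t :: real. t > 0) at_top" by (rule eventually_gt_at_top)
  show thesis
  proof (cases "m > 0")
    case True
    then have "filterlim (\<lambda>t. m * ln t) at_bot (at_right 0)" "filterlim (\<lambda>t. m * ln t) at_top at_top"
      using filterlim_tendsto_pos_mult_at_bot[OF tendsto_const _ ln_at_0]
        filterlim_tendsto_pos_mult_at_top[OF tendsto_const _ ln_at_top] by blast+
    from that[OF bot[OF this(1) pos0] _ top[OF this(2) pos1]] show thesis by simp
  next
    case False
    then have "m < 0" using m by simp
    then have "filterlim (\<lambda>t. m * ln t) at_top (at_right 0)" "filterlim (\<lambda>t. m * ln t) at_bot at_top"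
      using filterlim_tendsto_neg_mult_at_top_iff[OF tendsto_const] ln_at_0
        filterlim_tendsto_neg_mult_at_bot_iff[OF tendsto_const] ln_at_top by blast+
    from that[OF top[OF this(1) pos0] _ bot[OF this(2) pos1]] show thesis by simp
  qed
qed

section \<open>Risk of constant estimators\<close>

definition constant_risk :: "(real \<Rightarrow> real) \<Rightarrow> (real \<Rightarrow> real) \<Rightarrow> nat \<Rightarrow> real \<Rightarrow> ennreal" where
  "constant_risk \<rho> \<beta> d l = (\<integral>\<^sup>+z. ennreal (\<rho> (l / \<beta> z)) \<partial>chi_square d)"

lemma risk_of_constant:
  fixes \<delta> :: "(nat \<Rightarrow> real ^ 'd) \<Rightarrow> real"
  assumes n: "n \<ge> 1" and v: "v > 0"
    and [measurable]: "\<beta> \<in> borel_measurable borel" "\<rho> \<in> borel_measurable borel"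
    and \<delta>: "\<And>x. x \<in> space (sample_space n) \<Longrightarrow> \<delta> x = c"
  shows "risk (ratio_loss \<rho>) \<beta> n \<mu> v \<delta> = constant_risk \<rho> \<beta> CARD('d) c"
proof -
  have v': "v / real n > 0" using n v by simp
  have "risk (ratio_loss \<rho>) \<beta> n \<mu> v \<delta>
      = (\<integral>\<^sup>+x. ennreal (\<rho> (c / \<beta> ((norm (sample_mean n x - \<mu>))\<^sup>2 / (v / real n)))) \<partial>sample_law n \<mu> v)"
    unfolding risk_def ratio_loss_def first_loss_def by (intro nn_integral_cong) (simp add: \<delta>)
  also have "\<dots> = (\<integral>\<^sup>+z. ennreal (\<rho> (c / \<beta> ((norm (z :: real ^ 'd))\<^sup>2 / (v / real n)))) \<partial>iso_normal 0 (v / real n))"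
    by (rule nn_integral_sample_mean[OF n v]) measurable
  also have "\<dots> = constant_risk \<rho> \<beta> CARD('d) c"
    using nn_integral_chi_square[OF _ v', of "\<lambda>z. ennreal (\<rho> (c / \<beta> z))" "0 :: real ^ 'd"]
    by (simp add: constant_risk_def)
  finally show ?thesis .
qed

lemma posterior_risk_uniform:
  fixes x :: "nat \<Rightarrow> real ^ 'd"
  assumes n: "n \<ge> 1" and v: "v > 0"
    and [measurable]: "\<beta> \<in> borel_measurable borel" "\<rho> \<in> borel_measurable borel"
  shows "posterior_risk (ratio_loss \<rho>) \<beta> uniform_prior n v x l = constant_risk \<rho> \<beta> CARD('d) l"
proof -
  have v': "v / real n > 0" using n v by simp
  show ?thesis
    using nn_integral_chi_square[OF _ v', of "\<lambda>z. ennreal (\<rho> (l / \<beta> z))" "sample_mean n x"]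
    unfolding posterior_risk_def ratio_loss_def first_loss_def posterior_uniform[OF n v] constant_risk_def
    by (simp add: norm_minus_commute)
qed

text \<open>It suffices to bound the risks of a competitor for variance \<open>1\<close>.  For \<open>q\<close> below the minimal risk, the
  truncation lemma gives a level \<open>k\<close> at which no value \<open>l\<close> has truncated risk \<open>\<le> q\<close>; truncating
  the chi-square variable at \<open>k\<^sup>2 * n\<close> means restricting the error of the sample mean to the ball
  of radius \<open>k\<close>, so the bound for location problems applies.\<close>

lemma minimax_constant:
  fixes \<delta> :: "(nat \<Rightarrow> real ^ 'd) \<Rightarrow> real"
  assumes n: "n \<ge> 1"
    and \<beta> [measurable]: "\<beta> \<in> borel_measurable borel" and \<beta>_pos: "\<And>z. z > 0 \<Longrightarrow> \<beta> z > 0"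
    and \<rho> [measurable]: "\<rho> \<in> borel_measurable borel" and cont: "\<And>t. t > 0 \<Longrightarrow> isCont \<rho> t"
    and at_zero: "((\<lambda>t. ennreal (\<rho> t)) \<longlongrightarrow> e0) (at_right 0)" "constant_risk \<rho> \<beta> CARD('d) c \<le> e0"
    and at_inf: "((\<lambda>t. ennreal (\<rho> t)) \<longlongrightarrow> e1) at_top" "constant_risk \<rho> \<beta> CARD('d) c \<le> e1"
    and min: "\<And>l. l > 0 \<Longrightarrow> constant_risk \<rho> \<beta> CARD('d) c \<le> constant_risk \<rho> \<beta> CARD('d) l"
    and fin: "constant_risk \<rho> \<beta> CARD('d) c < \<infinity>"
    and est: "\<delta> \<in> estimators n" and \<delta>: "\<And>x. x \<in> space (sample_space n) \<Longrightarrow> \<delta> x = c"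
  shows "minimax (ratio_loss \<rho>) \<beta> n \<delta>"
proof -
  let ?r = "constant_risk \<rho> \<beta> CARD('d) c"
  interpret chi: prob_space "chi_square CARD('d)" by (rule prob_space_chi_square)
  have "sup_risk (ratio_loss \<rho>) \<beta> n \<delta> = (SUP (\<mu> :: real ^ 'd, v :: real) \<in> UNIV \<times> {0<..}. ?r)"
    unfolding sup_risk_def using n \<delta> by (intro SUP_cong) (auto intro!: risk_of_constant)
  also have "\<dots> = ?r"
    by (simp add: split_def)
  finally have sup: "sup_risk (ratio_loss \<rho>) \<beta> n \<delta> = ?r" .
  have lower: "?r \<le> sup_risk (ratio_loss \<rho>) \<beta> n \<delta>'" if \<delta>': "\<delta>' \<in> estimators n"
    for \<delta>' :: "(nat \<Rightarrow> real ^ 'd) \<Rightarrow> real"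
  proof (rule dense_le)
    fix q assume q: "q < ?r"
    have [measurable]: "\<delta>' \<in> borel_measurable (sample_space n)"
      and \<delta>'_pos: "\<And>x. x \<in> space (sample_space n) \<Longrightarrow> 0 < \<delta>' x"
      using \<delta>' by (auto simp: estimators_def)
    define A where "A k = {.. (real k)\<^sup>2 * real n}" for k
    have [measurable]: "A k \<in> sets borel" for k by (simp add: A_def)
    have "\<exists>k. \<forall>l>0. q < (\<integral>\<^sup>+z. ennreal (\<rho> (l / \<beta> z)) * indicator (A k) z \<partial>chi_square CARD('d))"
    proof (rule truncated_risk_recovers_infimum)
      show "AE z in chi_square CARD('d). 0 < \<beta> z"
        using AE_chi_square_pos by eventually_elim (rule \<beta>_pos)
      show "AE z in chi_square CARD('d). eventually (\<lambda>k. z \<in> A k) sequentially"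
      proof (rule AE_I2)
        fix z :: real
        obtain k0 :: nat where k0: "z \<le> real k0" using real_arch_simple by blast
        have "z \<in> A k" if "k \<ge> max k0 1" for k
        proof -
          have "z \<le> real k" using k0 that by simp
          also have "real k \<le> real k * real k" using that by simp
          also have "\<dots> \<le> real k * real k * real n" using n by (simp add: mult_le_cancel_left1)
          finally show ?thesis by (simp add: A_def power2_eq_square)
        qed
        then show "eventually (\<lambda>k. z \<in> A k) sequentially"
          unfolding eventually_sequentially by blast
      qed
      show "?r \<le> (\<integral>\<^sup>+z. ennreal (\<rho> (l / \<beta> z)) \<partial>chi_square CARD('d))" if "l > 0" for l
        using min[OF that] by (simp add: constant_risk_def)
    qed (fact \<beta> | fact \<rho> | fact chi.prob_space_axioms | fact at_zero | fact at_inf | fact q | simp add: cont)+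
    then obtain k where k: "\<And>l. l > 0 \<Longrightarrow>
        q < (\<integral>\<^sup>+z. ennreal (\<rho> (l / \<beta> z)) * indicator (A k) z \<partial>chi_square CARD('d))"
      by blast
    define h :: "real ^ 'd \<Rightarrow> real \<Rightarrow> ennreal"
      where "h z l = ennreal (\<rho> (l / \<beta> ((norm z)\<^sup>2 / (1 / real n))))" for z l
    have ball: "(norm z)\<^sup>2 * real n \<in> A k \<longleftrightarrow> norm z \<le> real k" for z :: "real ^ 'd"
      using n abs_le_square_iff[of "norm z" "real k"] by (simp add: A_def mult.commute)
    show "q \<le> sup_risk (ratio_loss \<rho>) \<beta> n \<delta>'"
    proof (rule location_risk_lower_bound[OF n zero_less_one, of "real k" q h \<delta>'])
      show "q < \<infinity>" using q fin by (rule less_trans)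
      show "case_prod h \<in> borel_measurable (borel \<Otimes>\<^sub>M borel)"
        unfolding h_def by measurable
      fix x :: "nat \<Rightarrow> real ^ 'd" assume x: "x \<in> space (sample_space n)"
      have "q \<le> (\<integral>\<^sup>+z. ennreal (\<rho> (\<delta>' x / \<beta> z)) * indicator (A k) z \<partial>chi_square CARD('d))"
        using k[OF \<delta>'_pos[OF x]] by simp
      also have "\<dots> = (\<integral>\<^sup>+z. h z (\<delta>' x) * indicator (cball 0 (real k)) z \<partial>iso_normal 0 (1 / real n))"
        using n nn_integral_chi_square[of "\<lambda>z. ennreal (\<rho> (\<delta>' x / \<beta> z)) * indicator (A k) z" "1 / real n" "0 :: real ^ 'd"]
        by (simp add: h_def indicator_def ball)
      finally show "q \<le> (\<integral>\<^sup>+z. h z (\<delta>' x) * indicator (cball 0 (real k)) z \<partial>iso_normal 0 (1 / real n))" .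
    next
      fix \<mu> :: "real ^ 'd"
      have "risk (ratio_loss \<rho>) \<beta> n \<mu> 1 \<delta>' \<le> sup_risk (ratio_loss \<rho>) \<beta> n \<delta>'"
        unfolding sup_risk_def by (rule SUP_upper2[of "(\<mu>, 1)"]) auto
      then show "(\<integral>\<^sup>+x. h (sample_mean n x - \<mu>) (\<delta>' x) \<partial>sample_law n \<mu> 1) \<le> sup_risk (ratio_loss \<rho>) \<beta> n \<delta>'"
        by (simp add: risk_def ratio_loss_def first_loss_def h_def)
    qed simp_all
  qed
  show ?thesis
    unfolding minimax_def sup using est lower
    by (auto intro!: antisym INF_greatest intro: INF_lower2[OF est] simp: sup)
qed

text \<open>A generalized Bayes estimator is only known to minimize the posterior risk at each sample
  separately; uniqueness of the minimizer is what makes it constant.  If \<open>c\<close> and \<open>c'\<close> were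
  different minimizers, the value \<open>k\<close> of the midpoint inequality would have strictly smaller risk.\<close>

lemma constant_risk_minimizer_unique:
  assumes [measurable]: "\<beta> \<in> borel_measurable borel" "\<rho> \<in> borel_measurable borel"
    and \<beta>_pos: "\<And>z. z > 0 \<Longrightarrow> \<beta> z > 0"
    and nonneg: "\<And>t. t > 0 \<Longrightarrow> \<rho> t \<ge> 0"
    and midpoint: "\<And>l l'. l > 0 \<Longrightarrow> l' > 0 \<Longrightarrow> l \<noteq> l' \<Longrightarrow>
      \<exists>k>0. \<forall>b>0. 2 * \<rho> (k / b) < \<rho> (l / b) + \<rho> (l' / b)"
    and c: "c > 0" "constant_risk \<rho> \<beta> CARD('d::finite) c < \<infinity>"
      "\<And>l. l > 0 \<Longrightarrow> constant_risk \<rho> \<beta> CARD('d) c \<le> constant_risk \<rho> \<beta> CARD('d) l"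
    and c': "c' > 0" "\<And>l. l > 0 \<Longrightarrow> constant_risk \<rho> \<beta> CARD('d) c' \<le> constant_risk \<rho> \<beta> CARD('d) l"
  shows "c = c'"
proof (rule ccontr)
  let ?F = "constant_risk \<rho> \<beta> CARD('d)" and ?\<chi> = "chi_square CARD('d)"
  interpret chi: prob_space ?\<chi> by (rule prob_space_chi_square)
  assume "c \<noteq> c'"
  then obtain k where k: "k > 0" and mid: "\<And>b. b > 0 \<Longrightarrow> 2 * \<rho> (k / b) < \<rho> (c / b) + \<rho> (c' / b)"
    using midpoint[OF c(1) c'(1)] by blast
  have eq: "?F c = ?F c'" using c c' by (auto intro: antisym)
  let ?f = "\<lambda>z. 2 * ennreal (\<rho> (k / \<beta> z))" and ?g = "\<lambda>z. ennreal (\<rho> (c / \<beta> z)) + ennreal (\<rho> (c' / \<beta> z))"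
  have less: "AE z in ?\<chi>. ?f z < ?g z"
    using AE_chi_square_pos
  proof eventually_elim
    case (elim z)
    have b: "\<beta> z > 0" using \<beta>_pos elim .
    have "?f z = ennreal (2 * \<rho> (k / \<beta> z))"
      using ennreal_mult'[of 2] by simp
    also have "\<dots> < ennreal (\<rho> (c / \<beta> z) + \<rho> (c' / \<beta> z))"
      using mid[OF b] nonneg k b by (intro ennreal_lessI) (auto intro: le_less_trans[of 0 "2 * \<rho> (k / \<beta> z)"])
    also have "\<dots> = ?g z" using nonneg b c(1) c'(1) by (intro ennreal_plus) auto
    finally show ?case .
  qed
  have f: "(\<integral>\<^sup>+z. ?f z \<partial>?\<chi>) = 2 * ?F k" by (simp add: constant_risk_def nn_integral_cmult)
  have g: "(\<integral>\<^sup>+z. ?g z \<partial>?\<chi>) = ?F c + ?F c'" by (simp add: constant_risk_def nn_integral_add)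
  have le: "2 * ?F c \<le> 2 * ?F k" by (intro mult_left_mono c(3) k) simp
  have "(\<integral>\<^sup>+z. ?f z \<partial>?\<chi>) \<le> (\<integral>\<^sup>+z. ?g z \<partial>?\<chi>)"
    using less by (intro nn_integral_mono_AE) (auto elim: eventually_mono)
  then have "(\<integral>\<^sup>+z. ?f z \<partial>?\<chi>) \<noteq> \<infinity>"
    using c(2) unfolding g by (auto simp: eq top_unique)
  moreover have "\<not> (AE z in ?\<chi>. ?g z \<le> ?f z)"
  proof
    assume "AE z in ?\<chi>. ?g z \<le> ?f z"
    with less have "AE z in ?\<chi>. False" by eventually_elim auto
    then show False by simp
  qed
  ultimately have "(\<integral>\<^sup>+z. ?f z \<partial>?\<chi>) < (\<integral>\<^sup>+z. ?g z \<partial>?\<chi>)"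
    using less by (intro nn_integral_less) (auto elim: eventually_mono)
  then show False using le unfolding f g by (simp add: eq mult_2)
qed

section \<open>Minimizers of the constant risk\<close>

text \<open>The loss \<open>rho_A m\<close> stays bounded as \<open>l\<close> escapes to one end of \<open>(0,\<infinity>)\<close>, with limit \<open>1\<close>; the
  minimal risk does not exceed that limit.  Multiplying \<open>c\<close> by \<open>\<epsilon> powr (1 / m)\<close> multiplies
  \<open>W = (c / \<beta> z) powr m\<close> by \<open>\<epsilon>\<close>, and since \<open>W > 0\<close> the loss is at most \<open>1 + \<epsilon>\<^sup>2 * W\<^sup>2\<close>, where the second moment of
  \<open>W\<close> is controlled by the risk of \<open>c\<close>.\<close>

lemma constant_risk_rho_A_le_1:
  assumes m: "m \<noteq> 0"
    and [measurable]: "\<beta> \<in> borel_measurable borel" and \<beta>_pos: "\<And>z. z > 0 \<Longrightarrow> \<beta> z > 0"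
    and c: "c > 0" and fin: "constant_risk (rho_A m) \<beta> CARD('d::finite) c < \<infinity>"
    and min: "\<And>l. l > 0 \<Longrightarrow>
      constant_risk (rho_A m) \<beta> CARD('d) c \<le> constant_risk (rho_A m) \<beta> CARD('d) l"
  shows "constant_risk (rho_A m) \<beta> CARD('d) c \<le> 1"
proof (rule ccontr)
  interpret chi: prob_space "chi_square CARD('d)" by (rule prob_space_chi_square)
  let ?F = "constant_risk (rho_A m) \<beta> CARD('d)"
  have bound: "?F c \<le> 1 + ennreal (\<epsilon>\<^sup>2) * (2 * ?F c + 2)" if \<epsilon>: "\<epsilon> > 0" for \<epsilon> :: real
  proof -
    have "?F c \<le> ?F (c * \<epsilon> powr (1 / m))" using c \<epsilon> by (intro min) simp
    also have "\<dots> \<le> (\<integral>\<^sup>+z. 1 + ennreal (\<epsilon>\<^sup>2) * (2 * ennreal (rho_A m (c / \<beta> z)) + 2) \<partial>chi_square CARD('d))"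
      unfolding constant_risk_def
    proof (rule nn_integral_mono_AE, use AE_chi_square_pos in eventually_elim)
      case (elim z)
      have b: "\<beta> z > 0" using \<beta>_pos elim .
      define W where "W = (c / \<beta> z) powr m"
      have W: "W > 0" using b c by (simp add: W_def)
      have "(c * \<epsilon> powr (1 / m) / \<beta> z) powr m = \<epsilon> * W"
        using b c \<epsilon> m by (simp add: W_def powr_mult powr_divide powr_powr)
      then have "rho_A m (c * \<epsilon> powr (1 / m) / \<beta> z) = 1 + \<epsilon>\<^sup>2 * W\<^sup>2 - 2 * \<epsilon> * W"
        by (simp add: rho_A_def power2_eq_square algebra_simps)
      also have "\<dots> \<le> 1 + \<epsilon>\<^sup>2 * W\<^sup>2" using W \<epsilon> by simp
      also have "W\<^sup>2 \<le> 2 * (W - 1)\<^sup>2 + 2"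
        using zero_le_power2[of "W - 2"] by (simp add: power2_eq_square algebra_simps)
      then have "1 + \<epsilon>\<^sup>2 * W\<^sup>2 \<le> 1 + \<epsilon>\<^sup>2 * (2 * rho_A m (c / \<beta> z) + 2)"
        unfolding rho_A_def W_def[symmetric] by (intro add_left_mono mult_left_mono) simp_all
      finally have "ennreal (rho_A m (c * \<epsilon> powr (1 / m) / \<beta> z))
          \<le> ennreal (1 + \<epsilon>\<^sup>2 * (2 * rho_A m (c / \<beta> z) + 2))"
        by (rule ennreal_leI)
      also have "\<dots> = 1 + ennreal (\<epsilon>\<^sup>2) * (2 * ennreal (rho_A m (c / \<beta> z)) + 2)"
        by (simp add: rho_A_def ennreal_mult' ennreal_plus)
      finally show ?case .
    qed
    also have "\<dots> = 1 + ennreal (\<epsilon>\<^sup>2) * (2 * ?F c + 2)"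
      by (simp add: nn_integral_add nn_integral_cmult constant_risk_def chi.emeasure_space_1[simplified])
    finally show ?thesis .
  qed
  obtain r where r: "?F c = ennreal r" "r \<ge> 0" using fin by (cases "?F c") auto
  assume "\<not> ?F c \<le> 1"
  then have r1: "r > 1" using r by (simp add: not_le)
  \<comment> \<open>With \<open>\<eta> = \<epsilon>\<^sup>2\<close>, this choice makes the correction term half of \<open>r - 1\<close>.\<close>
  define \<eta> where "\<eta> = (r - 1) / (2 * (2 * r + 2))"
  have \<eta>: "\<eta> > 0" using r1 by (simp add: \<eta>_def)
  have "ennreal r \<le> 1 + ennreal \<eta> * (2 * ennreal r + 2)"
    using bound[of "sqrt \<eta>"] \<eta> r by simp
  also have "\<dots> = ennreal (1 + \<eta> * (2 * r + 2))"
    using \<eta> r by (simp add: ennreal_mult' ennreal_plus)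
  finally have "r \<le> 1 + \<eta> * (2 * r + 2)"
    using \<eta> r by (subst (asm) ennreal_le_iff) simp_all
  also have "\<dots> = 1 + (r - 1) / 2" using r1 by (simp add: \<eta>_def divide_simps algebra_simps)
  finally show False using r1 by (simp add: field_simps)
qed

text \<open>With \<open>a\<close> the expectation of \<open>\<beta> powr (-m)\<close> and \<open>u = l powr m * a\<close>, the risk of \<open>l\<close> is \<open>u - ln u - 1\<close> plus
  a term free of \<open>l\<close>, so it is minimal for \<open>u = 1\<close>, which is \<open>l = a powr (-1 / m)\<close>.\<close>

lemma rho_minimizer:
  fixes m :: real
  assumes m: "m \<noteq> 0"
    and [measurable]: "\<beta> \<in> borel_measurable borel" and \<beta>_pos: "\<And>z. z > 0 \<Longrightarrow> \<beta> z > 0"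
    and ln: "integrable (chi_square CARD('d::finite)) (\<lambda>z. ln (\<beta> z))"
    and pw: "integrable (chi_square CARD('d)) (\<lambda>z. \<beta> z powr (- m))"
  defines "c \<equiv> (\<integral>z. \<beta> z powr (- m) \<partial>chi_square CARD('d)) powr (- 1 / m)"
  shows "c > 0" and "constant_risk (rho m) \<beta> CARD('d) c < \<infinity>"
    and "l > 0 \<Longrightarrow> constant_risk (rho m) \<beta> CARD('d) c \<le> constant_risk (rho m) \<beta> CARD('d) l"
proof -
  interpret chi: prob_space "chi_square CARD('d)" by (rule prob_space_chi_square)
  define a where "a = (\<integral>z. \<beta> z powr (- m) \<partial>chi_square CARD('d))"
  define e where "e = (\<integral>z. ln (\<beta> z) \<partial>chi_square CARD('d))"
  have pos: "AE z in chi_square CARD('d). 0 < \<beta> z"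
    using AE_chi_square_pos by eventually_elim (rule \<beta>_pos)
  have "a \<noteq> 0"
  proof
    assume "a = 0"
    then have "AE z in chi_square CARD('d). \<beta> z powr (- m) = 0"
      using integral_nonneg_eq_0_iff_AE[OF pw] by (simp add: a_def)
    with pos have "AE z in chi_square CARD('d). False" by eventually_elim simp
    then show False by simp
  qed
  moreover have "a \<ge> 0" unfolding a_def by (rule integral_nonneg_AE) simp
  ultimately have a: "a > 0" by simp
  then show c: "c > 0" by (simp add: c_def a_def[symmetric])
  have F: "constant_risk (rho m) \<beta> CARD('d) l
      = ennreal ((l powr m * a - ln (l powr m * a) - 1) + ln a + m * e)" if l: "l > 0" for l
  proof -
    let ?g = "\<lambda>z. l powr m * \<beta> z powr (- m) - m * ln l + m * ln (\<beta> z) - 1"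
    have eq: "AE z in chi_square CARD('d). rho m (l / \<beta> z) = ?g z \<and> 0 \<le> ?g z"
      using pos
    proof eventually_elim
      case (elim z)
      have "rho m (l / \<beta> z) = ?g z"
        using l elim by (simp add: rho_def powr_divide powr_minus_divide ln_div right_diff_distrib)
      moreover have "rho m (l / \<beta> z) \<ge> 0" using rho_nonneg l elim by simp
      ultimately show ?case by simp
    qed
    have int: "integrable (chi_square CARD('d)) ?g"
      by (intro Bochner_Integration.integrable_diff Bochner_Integration.integrable_add
          integrable_mult_right ln pw chi.integrable_const)
    have "constant_risk (rho m) \<beta> CARD('d) l = (\<integral>\<^sup>+z. ennreal (?g z) \<partial>chi_square CARD('d))"
      unfolding constant_risk_def by (rule nn_integral_cong_AE) (use eq in \<open>auto elim: eventually_mono\<close>)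
    also have "\<dots> = ennreal (\<integral>z. ?g z \<partial>chi_square CARD('d))"
      by (rule nn_integral_eq_integral[OF int]) (use eq in \<open>auto elim: eventually_mono\<close>)
    also have "(\<integral>z. ?g z \<partial>chi_square CARD('d)) = l powr m * a - m * ln l + m * e - 1"
      using ln pw by (simp add: a_def e_def chi.prob_space[simplified])
    also have "\<dots> = (l powr m * a - ln (l powr m * a) - 1) + ln a + m * e"
      using l a by (simp add: ln_mult ln_powr)
    finally show ?thesis .
  qed
  show "constant_risk (rho m) \<beta> CARD('d) c < \<infinity>" by (simp add: F[OF c])
  show "constant_risk (rho m) \<beta> CARD('d) c \<le> constant_risk (rho m) \<beta> CARD('d) l" if l: "l > 0"
  proof -
    have "c = a powr (- 1 / m)" by (simp add: c_def a_def)
    then have "c powr m = a powr (- 1 / m * m)" by (simp only: powr_powr)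
    also have "\<dots> = inverse a" using a m by (simp add: powr_minus)
    finally have "c powr m = inverse a" .
    then have "c powr m * a = 1" using a by simp
    moreover have "ln (l powr m * a) \<le> l powr m * a - 1" using l a by (intro ln_le_minus_one) simp
    ultimately show ?thesis unfolding F[OF c] F[OF l] by (intro ennreal_leI) simp
  qed
qed

section \<open>Minimax estimators of the loss\<close>

lemma generalized_bayes_uniform_minimax:
  fixes \<delta> :: "(nat \<Rightarrow> real ^ 'd) \<Rightarrow> real"
  assumes n: "n \<ge> 1" and v: "v > 0"
    and \<beta> [measurable]: "\<beta> \<in> borel_measurable borel" and \<beta>_pos: "\<And>z. z > 0 \<Longrightarrow> \<beta> z > 0"
    and \<rho>: "\<rho> \<in> {rho_A m |m. m \<noteq> 0} \<union> {rho_B, rho_C}"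
    and bayes: "generalized_bayes (ratio_loss \<rho>) \<beta> uniform_prior n v \<delta>"
  shows "minimax (ratio_loss \<rho>) \<beta> n \<delta>"
proof -
  consider (A) m where "m \<noteq> 0" "\<rho> = rho_A m" | (B) "\<rho> = rho_B" | (C) "\<rho> = rho_C"
    using \<rho> by blast
  note cases = this
  have \<rho>m [measurable]: "\<rho> \<in> borel_measurable borel"
    using cases by cases (simp_all add: measurable_losses)
  have nonneg: "\<rho> t \<ge> 0" if "t > 0" for t
    using cases that by cases (simp_all add: rho_A_def rho_B_nonneg rho_C_def)
  have cont: "isCont \<rho> t" if "t > 0" for t
    using cases by cases (simp_all add: isCont_losses that)
  have midpoint: "\<exists>k>0. \<forall>b>0. 2 * \<rho> (k / b) < \<rho> (l / b) + \<rho> (l' / b)"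
    if "l > 0" "l' > 0" "l \<noteq> l'" for l l'
    using cases
  proof cases
    case A
    show ?thesis unfolding A(2) by (rule midpoint_rho_A[OF A(1) that])
  next
    case B
    show ?thesis unfolding B by (rule midpoint_rho_B[OF that])
  next
    case C
    show ?thesis unfolding C by (rule midpoint_rho_C[OF that])
  qed
  let ?F = "constant_risk \<rho> \<beta> CARD('d)"
  have est: "\<delta> \<in> estimators n"
    and fin: "\<And>x. x \<in> space (sample_space n) \<Longrightarrow> ?F (\<delta> x) < \<infinity>"
    and min: "\<And>x l. x \<in> space (sample_space n) \<Longrightarrow> l > 0 \<Longrightarrow> ?F (\<delta> x) \<le> ?F l"
    using bayes unfolding generalized_bayes_def posterior_risk_uniform[OF n v \<beta> \<rho>m] by auto
  have pos: "\<And>x. x \<in> space (sample_space n) \<Longrightarrow> \<delta> x > 0" using est by (simp add: estimators_def)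
  define x0 :: "nat \<Rightarrow> real ^ 'd" where "x0 = (\<lambda>i\<in>{..<n}. 0)"
  have x0: "x0 \<in> space (sample_space n)" by (simp add: x0_def sample_space_def space_PiM)
  have const: "\<delta> x = \<delta> x0" if "x \<in> space (sample_space n)" for x
    by (rule constant_risk_minimizer_unique[OF \<beta> \<rho>m \<beta>_pos nonneg midpoint
          pos[OF that] fin[OF that] min[OF that] pos[OF x0] min[OF x0]])
  have "\<exists>e0 e1. ((\<lambda>t. ennreal (\<rho> t)) \<longlongrightarrow> e0) (at_right 0) \<and> ?F (\<delta> x0) \<le> e0
      \<and> ((\<lambda>t. ennreal (\<rho> t)) \<longlongrightarrow> e1) at_top \<and> ?F (\<delta> x0) \<le> e1"
    using cases
  proof cases
    case A
    have "?F (\<delta> x0) \<le> 1"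
      using fin[OF x0] min[OF x0] unfolding A(2)
      by (intro constant_risk_rho_A_le_1[OF A(1) \<beta> \<beta>_pos pos[OF x0]])
    moreover obtain e0 e1 where "((\<lambda>t. ennreal (\<rho> t)) \<longlongrightarrow> e0) (at_right 0)" "1 \<le> e0"
      "((\<lambda>t. ennreal (\<rho> t)) \<longlongrightarrow> e1) at_top" "1 \<le> e1"
      unfolding A(2) by (rule rho_A_limits[OF A(1)])
    ultimately show ?thesis by (blast intro: order_trans)
  next
    case B
    have "\<rho> t \<ge> 1 * \<bar>ln t\<bar> - 1" if "t > 0" for t using rho_B_ge_log[OF that] B by simp
    from coercive_in_log_tendsto_top[OF zero_less_one this] show ?thesis by (blast intro: top_greatest)
  next
    case C
    have "\<rho> t \<ge> 1 * \<bar>ln t\<bar> - 1" if "t > 0" for t using rho_C_ge_log[OF that] C by simp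
    from coercive_in_log_tendsto_top[OF zero_less_one this] show ?thesis by (blast intro: top_greatest)
  qed
  then obtain e0 e1 where e: "((\<lambda>t. ennreal (\<rho> t)) \<longlongrightarrow> e0) (at_right 0)" "?F (\<delta> x0) \<le> e0"
    "((\<lambda>t. ennreal (\<rho> t)) \<longlongrightarrow> e1) at_top" "?F (\<delta> x0) \<le> e1" by blast
  show ?thesis
    by (rule minimax_constant[where c = "\<delta> x0", OF n \<beta> \<beta>_pos \<rho>m cont e min[OF x0] fin[OF x0] est const])
qed

lemma minimax_rho:
  fixes m :: real
  assumes n: "n \<ge> 1" and m: "m \<noteq> 0"
    and \<beta> [measurable]: "\<beta> \<in> borel_measurable borel" and \<beta>_pos: "\<And>z. z > 0 \<Longrightarrow> \<beta> z > 0"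
    and ln: "integrable (chi_square CARD('d::finite)) (\<lambda>z. ln (\<beta> z))"
    and pw: "integrable (chi_square CARD('d)) (\<lambda>z. \<beta> z powr (- m))"
  shows "minimax (ratio_loss (rho m)) \<beta> n
    (\<lambda>x :: nat \<Rightarrow> real ^ 'd. (\<integral>z. \<beta> z powr (- m) \<partial>chi_square CARD('d)) powr (- 1 / m))"
proof -
  define c where "c = (\<integral>z. \<beta> z powr (- m) \<partial>chi_square CARD('d)) powr (- 1 / m)"
  note min = rho_minimizer[OF m \<beta> \<beta>_pos ln pw, folded c_def]
  have top: "((\<lambda>t. ennreal (rho m t)) \<longlongrightarrow> \<top>) (at_right 0)" "((\<lambda>t. ennreal (rho m t)) \<longlongrightarrow> \<top>) at_top"
    using coercive_in_log_tendsto_top[of "\<bar>m\<bar>" "rho m"] rho_ge_log m by auto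
  have est: "(\<lambda>x :: nat \<Rightarrow> real ^ 'd. c) \<in> estimators n" using min(1) by (simp add: estimators_def)
  show ?thesis
    unfolding c_def[symmetric]
    by (rule minimax_constant[where c = c, OF n \<beta> \<beta>_pos measurable_losses(1) isCont_losses(1) top(1) top_greatest top(2) top_greatest
          min(3) min(2) est refl])
qed

text \<open>Only the values of \<open>\<beta>\<close> on \<open>[0,\<infinity>)\<close> enter; this congruence and the next two facts allow \<open>\<beta>\<close> to be replaced
  by a Borel function on the whole line.\<close>

lemma minimax_cong_nonneg:
  assumes n: "n \<ge> 1" and eq: "\<And>z. z \<ge> 0 \<Longrightarrow> \<beta> z = \<beta>' z"
  shows "minimax W \<beta> n (\<delta> :: (nat \<Rightarrow> real ^ 'd) \<Rightarrow> real) \<longleftrightarrow> minimax W \<beta>' n \<delta>"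
proof -
  have "risk W \<beta> n \<mu> v \<delta> = risk W \<beta>' n \<mu> v \<delta>" if "v > 0" for \<mu> :: "real ^ 'd" and v \<delta>
    unfolding risk_def first_loss_def using that by (subst eq) auto
  then have "sup_risk W \<beta> n \<delta> = sup_risk W \<beta>' n \<delta>" for \<delta> :: "(nat \<Rightarrow> real ^ 'd) \<Rightarrow> real"
    unfolding sup_risk_def by (intro SUP_cong) auto
  then show ?thesis by (simp add: minimax_def)
qed

lemma generalized_bayes_cong_nonneg:
  assumes v: "v > 0" and eq: "\<And>z. z \<ge> 0 \<Longrightarrow> \<beta> z = \<beta>' z"
  shows "generalized_bayes W \<beta> prior n v (\<delta> :: (nat \<Rightarrow> real ^ 'd) \<Rightarrow> real)
    \<longleftrightarrow> generalized_bayes W \<beta>' prior n v \<delta>"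
proof -
  have "posterior_risk W \<beta> prior n v x l = posterior_risk W \<beta>' prior n v x l" for x :: "nat \<Rightarrow> real ^ 'd" and l
    unfolding posterior_risk_def first_loss_def using v by (subst eq) auto
  then show ?thesis by (simp add: generalized_bayes_def)
qed

lemma set_integral_chi_square:
  fixes f g :: "real \<Rightarrow> real"
  assumes [measurable]: "g \<in> borel_measurable borel" and eq: "\<And>z. z \<ge> 0 \<Longrightarrow> f z = g z"
  shows "set_integrable (chi_square CARD('d::finite)) {0..} f \<longleftrightarrow> integrable (chi_square CARD('d)) g"
    and "(LINT z:{0..}|chi_square CARD('d). f z) = (\<integral>z. g z \<partial>chi_square CARD('d))"
proof -
  have f: "(\<lambda>z. indicator {0..} z *\<^sub>R f z) = (\<lambda>z. indicator {0..} z *\<^sub>R g z)"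
    by (auto simp: fun_eq_iff indicator_def eq)
  have ae: "AE z in chi_square CARD('d). indicator {0..} z *\<^sub>R g z = g z"
    using AE_chi_square_pos by eventually_elim simp
  show "set_integrable (chi_square CARD('d)) {0..} f \<longleftrightarrow> integrable (chi_square CARD('d)) g"
    unfolding set_integrable_def f by (rule integrable_cong_AE) (use ae in simp_all)
  show "(LINT z:{0..}|chi_square CARD('d). f z) = (\<integral>z. g z \<partial>chi_square CARD('d))"
    unfolding set_lebesgue_integral_def f by (rule integral_cong_AE) (use ae in simp_all)
qed

theorem corollary1:
  fixes \<beta> :: "real \<Rightarrow> real" and n :: nat
  assumes n: "n \<ge> 1"
    and nonneg: "\<And>z. z \<ge> 0 \<Longrightarrow> \<beta> z \<ge> 0"
    and mono: "strict_mono_on {0..} \<beta>"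
    and ac: "abs_continuous_halfline \<beta>"
    and fin: "set_integrable (chi_square CARD('d::finite)) {0..} \<beta>"
  shows "(\<forall>m. m \<noteq> 0 \<longrightarrow>
            set_integrable (chi_square CARD('d)) {0..} (\<lambda>z. ln (\<beta> z)) \<longrightarrow>
            set_integrable (chi_square CARD('d)) {0..} (\<lambda>z. \<beta> z powr (- m)) \<longrightarrow>
            minimax (ratio_loss (rho m)) \<beta> n
              (\<lambda>x :: nat \<Rightarrow> real ^ 'd.
                 (LINT z:{0..}|chi_square CARD('d). \<beta> z powr (- m)) powr (- 1 / m)))
       \<and> (\<forall>\<rho> v (\<delta> :: (nat \<Rightarrow> real ^ 'd) \<Rightarrow> real).
            \<rho> \<in> {rho_A m |m. m \<noteq> 0} \<union> {rho_B, rho_C} \<longrightarrow> v > 0 \<longrightarrow>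
            generalized_bayes (ratio_loss \<rho>) \<beta> uniform_prior n v \<delta> \<longrightarrow>
            (\<forall>\<mu>. \<forall>s>0. risk (ratio_loss \<rho>) \<beta> n \<mu> s \<delta> < \<infinity>) \<longrightarrow>
            minimax (ratio_loss \<rho>) \<beta> n \<delta>)"
proof -
  \<comment> \<open>Constant continuation to the left keeps \<open>\<beta>\<close> monotone, hence Borel measurable.\<close>
  define B where "B z = \<beta> (max 0 z)" for z
  have B: "\<beta> z = B z" if "z \<ge> 0" for z using that by (simp add: B_def)
  have "mono B"
    using strict_mono_onD[OF mono] by (auto intro!: monoI simp: B_def less_eq_real_def max_def)
  then have [measurable]: "B \<in> borel_measurable borel" by (rule borel_measurable_mono)
  have B_pos: "B z > 0" if "z > 0" for z
    using strict_mono_onD[OF mono, of 0 z] nonneg[of 0] that by (simp add: B_def)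
  have minimax_B: "minimax W \<beta> n \<delta> \<longleftrightarrow> minimax W B n \<delta>" for W and \<delta> :: "(nat \<Rightarrow> real ^ 'd) \<Rightarrow> real"
    using n B by (rule minimax_cong_nonneg)
  show ?thesis
    unfolding minimax_B
  proof (intro conjI allI impI)
    fix m :: real
    assume m: "m \<noteq> 0" and "set_integrable (chi_square CARD('d)) {0..} (\<lambda>z. ln (\<beta> z))"
      and "set_integrable (chi_square CARD('d)) {0..} (\<lambda>z. \<beta> z powr (- m))"
    then have int: "integrable (chi_square CARD('d)) (\<lambda>z. ln (B z))"
        "integrable (chi_square CARD('d)) (\<lambda>z. B z powr (- m))"
      using set_integral_chi_square(1)[of "\<lambda>z. ln (B z)" "\<lambda>z. ln (\<beta> z)", where 'd = 'd]
        set_integral_chi_square(1)[of "\<lambda>z. B z powr (- m)" "\<lambda>z. \<beta> z powr (- m)", where 'd = 'd]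
      by (simp_all add: B)
    define c where "c = (\<integral>z. B z powr (- m) \<partial>chi_square CARD('d)) powr (- 1 / m)"
    have c_eq: "(LINT z:{0..}|chi_square CARD('d). \<beta> z powr (- m)) powr (- 1 / m) = c"
      unfolding c_def by (subst set_integral_chi_square(2)[where g = "\<lambda>z. B z powr (- m)"]) (simp_all add: B)
    show "minimax (ratio_loss (rho m)) B n
        (\<lambda>x :: nat \<Rightarrow> real ^ 'd. (LINT z:{0..}|chi_square CARD('d). \<beta> z powr (- m)) powr (- 1 / m))"
      unfolding c_eq c_def using n by (intro minimax_rho m B_pos int) simp_all
  next
    fix \<rho> v and \<delta> :: "(nat \<Rightarrow> real ^ 'd) \<Rightarrow> real"
    assume \<rho>: "\<rho> \<in> {rho_A m |m. m \<noteq> 0} \<union> {rho_B, rho_C}" and v: "v > 0"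
      and "generalized_bayes (ratio_loss \<rho>) \<beta> uniform_prior n v \<delta>"
    then have "generalized_bayes (ratio_loss \<rho>) B uniform_prior n v \<delta>"
      using generalized_bayes_cong_nonneg[OF v, of \<beta> B] B by blast
    with n v \<open>B \<in> borel_measurable borel\<close> B_pos \<rho> show "minimax (ratio_loss \<rho>) B n \<delta>"
      by (rule generalized_bayes_uniform_minimax)
  qed
qed

end
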